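(* Let $K$ be a field, and consider the potentials on the quiver $X_7$ $$W_0=B_1+B_2+B_3+\Delta_1\Delta_2+\Delta_2\Delta_3+\Delta_3\Delta_1,\qquad W_1=W_0+\Delta_1\Delta_2\Delta_3,$$ with Jacobian algebras $\Lambda_0=\mathcal P(X_7,W_0)$ and $\Lambda_1=\mathcal P(X_7,W_1)$ over $K$. (a) If $\operatorname{char}K\neq 2$, then the algebras $\Lambda_0$ and $\Lambda_1$ are finite-dimensional over $K$. (b) If $\operatorname{char}K=2$, then $\Lambda_0$ is infinite-dimensional while $\Lambda_1$ is finite-dimensional.
   Context: **The quiver $X_7$.** It has vertices $0,1,\dots,6$ and, for each $i\in\{1,2,3\}$, arrows $\alpha_i:0\to 2i-1$, $\beta_i:2i-1\to 2i$, $\delta_i:2i-1\to 2i$, $\gamma_i:2i\to 0$. Set $B_i=\alpha_i\beta_i\gamma_i$ and $\Delta_i=\alpha_i\delta_i\gamma_i$. Paths are composed left to right. **Jacobian algebra.** For a quiver $Q$, $\widehat{KQ}$ is the completion of the path algebra at the ideal generated by the arrows. A potential is a (possibly infinite) linear combination of cycles of length at least $2$. For an arrow $\alpha$, the cyclic derivative $\partial_\alpha$ is the continuous linear map with $\partial_\alpha(\alpha_1\cdots\alpha_n)=\sum_{i:\alpha_i=\alpha}\alpha_{i+1}\cdots\alpha_n\alpha_1\cdots\alpha_{i-1}$ on cycles. The Jacobian algebra is $\mathcal P(Q,W)=\widehat{KQ}/\overline{(\partial_\alpha(W):\alpha\in Q_1)}$, the quotient by the closure of the two-sided ideal generated by all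 cyclic derivatives of $W$ with respect to arrows. *)

theory Defs
  imports
    "Graph_Theory.Arc_Walk"
    "HOL-Algebra.Embedded_Algebras"
    "HOL-Algebra.QuotRing"
begin

section \<open>Paths and the completed path algebra of a quiver\<close>

text \<open>
  A quiver is a \<^typ>\<open>('v, 'a) pre_digraph\<close> (parallel arrows and loops are allowed).  A path is a
  pair \<open>(u, p)\<close> of its starting vertex and its list of arrows, read from left to right;
  \<open>(u, [])\<close> is the trivial path at \<open>u\<close>.
\<close>

definition quiver_paths :: "('v, 'a) pre_digraph \<Rightarrow> ('v \<times> 'a list) set" where
  "quiver_paths Q = {(u, p). \<exists>v. pre_digraph.awalk Q u p v}"

definition quiver_cycles :: "('v, 'a) pre_digraph \<Rightarrow> ('v \<times> 'a list) set" where
  "quiver_cycles Q = {(u, p). pre_digraph.awalk Q u p u}"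

text \<open>
  A possibly infinite linear combination of paths is represented by its coefficient function.
  For a finite quiver the quotient of \<open>KQ\<close> by the \<open>n\<close>-th power of the arrow ideal has the paths of
  length less than \<open>n\<close> as a basis, so the inverse limit of these quotients consists of all
  coefficient functions on paths, with convolution as product.
\<close>

type_synonym ('v, 'a, 'k) path_series = "'v \<times> 'a list \<Rightarrow> 'k"

definition path_series_scalar ::
    "('v, 'a) pre_digraph \<Rightarrow> 'k \<Rightarrow> ('v, 'a, 'k::field) path_series" where
  "path_series_scalar Q c = (\<lambda>(u, p). if u \<in> verts Q \<and> p = [] then c else 0)"

definition path_series_mult :: "('v, 'a) pre_digraph \<Rightarrow> ('v, 'a, 'k::field) path_series \<Rightarrow>
    ('v, 'a, 'k) path_series \<Rightarrow> ('v, 'a, 'k) path_series" where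
  "path_series_mult Q f g = (\<lambda>(u, p). \<Sum>k\<le>length p.
     f (u, take k p) * g (pre_digraph.awlast Q u (take k p), drop k p))"

definition complete_path_algebra ::
    "('v, 'a) pre_digraph \<Rightarrow> ('v, 'a, 'k::field) path_series ring" where
  "complete_path_algebra Q =
     \<lparr>carrier = {f. \<forall>s. s \<notin> quiver_paths Q \<longrightarrow> f s = 0},
      mult = path_series_mult Q,
      one = path_series_scalar Q 1,
      zero = (\<lambda>_. 0),
      add = (\<lambda>f g s. f s + g s)\<rparr>"

definition arrow_series :: "('v, 'a) pre_digraph \<Rightarrow> 'a \<Rightarrow> ('v, 'a, 'k::field) path_series" where
  "arrow_series Q a = (\<lambda>s. if s = (tail Q a, [a]) then 1 else 0)"


section \<open>Jacobian algebras\<close>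

definition potentials :: "('v, 'a) pre_digraph \<Rightarrow> ('v, 'a, 'k::field) path_series set" where
  "potentials Q = {W. \<forall>u p. W (u, p) \<noteq> 0 \<longrightarrow> (u, p) \<in> quiver_cycles Q \<and> 2 \<le> length p}"

text \<open>
  The coefficient at \<open>s\<close> collects all pairs of a cycle \<open>c\<close> and an occurrence \<open>c ! i = a\<close> such that
  deleting this occurrence and rotating cyclically yields the path \<open>s\<close>.  In a finite quiver there
  are only finitely many such pairs, all cycles involved having the same length.
\<close>

definition cyclic_derivative :: "('v, 'a) pre_digraph \<Rightarrow> 'a \<Rightarrow> ('v, 'a, 'k::field) path_series \<Rightarrow>
    ('v, 'a, 'k) path_series" where
  "cyclic_derivative Q a W = (\<lambda>s. \<Sum>((u, c), i) \<in>
     {((u, c), i). (u, c) \<in> quiver_cycles Q \<and> i < length c \<and> c ! i = a \<and>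
        (head Q a, drop (Suc i) c @ take i c) = s}. W (u, c))"

text \<open>
  The closure is taken with respect to the arrow ideal topology: the \<open>n\<close>-th basic neighbourhood
  of \<open>0\<close> consists of the series without terms of length less than \<open>n\<close>.
\<close>

definition path_series_closure :: "('v, 'a) pre_digraph \<Rightarrow> ('v, 'a, 'k::field) path_series set \<Rightarrow>
    ('v, 'a, 'k) path_series set" where
  "path_series_closure Q S = {f \<in> carrier (complete_path_algebra Q).
     \<forall>n. \<exists>g\<in>S. \<forall>u p. length p < n \<longrightarrow> f (u, p) = g (u, p)}"

definition jacobian_ideal :: "('v, 'a) pre_digraph \<Rightarrow> ('v, 'a, 'k::field) path_series \<Rightarrow>
    ('v, 'a, 'k) path_series set" where
  "jacobian_ideal Q W = path_series_closure Q
     (Idl\<^bsub>complete_path_algebra Q\<^esub> {cyclic_derivative Q a W |a. a \<in> arcs Q})"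

definition jacobian_algebra :: "('v, 'a) pre_digraph \<Rightarrow> ('v, 'a, 'k::field) path_series \<Rightarrow>
    ('v, 'a, 'k) path_series set ring" where
  "jacobian_algebra Q W = complete_path_algebra Q Quot jacobian_ideal Q W"

text \<open>
  In \<^theory>\<open>HOL-Algebra.Embedded_Algebras\<close> the dimension of an algebra is taken over a subfield of
  the underlying ring; here this subfield is the copy of the ground field in the Jacobian algebra,
  that is, the image of the scalar multiples of the unit.
\<close>

definition jacobian_scalars :: "('v, 'a) pre_digraph \<Rightarrow> ('v, 'a, 'k::field) path_series \<Rightarrow>
    ('v, 'a, 'k) path_series set set" where
  "jacobian_scalars Q W =
     range (\<lambda>c. jacobian_ideal Q W +>\<^bsub>complete_path_algebra Q\<^esub> path_series_scalar Q c)"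

definition finite_dim_jacobian_algebra ::
    "('v, 'a) pre_digraph \<Rightarrow> ('v, 'a, 'k::field) path_series \<Rightarrow> bool" where
  "finite_dim_jacobian_algebra Q W \<longleftrightarrow>
     ring.finite_dimension (jacobian_algebra Q W) (jacobian_scalars Q W)
       (carrier (jacobian_algebra Q W))"


section \<open>The quiver \<open>X\<^sub>7\<close> and its potentials\<close>

datatype X7_arrow = Alpha nat | Beta nat | Gamma nat | Delta nat

fun X7_tail :: "X7_arrow \<Rightarrow> nat" where
  "X7_tail (Alpha i) = 0"
| "X7_tail (Beta i) = 2 * i - 1"
| "X7_tail (Delta i) = 2 * i - 1"
| "X7_tail (Gamma i) = 2 * i"

fun X7_head :: "X7_arrow \<Rightarrow> nat" where
  "X7_head (Alpha i) = 2 * i - 1"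
| "X7_head (Beta i) = 2 * i"
| "X7_head (Delta i) = 2 * i"
| "X7_head (Gamma i) = 0"

definition X7 :: "(nat, X7_arrow) pre_digraph" where
  "X7 = \<lparr>verts = {0..6},
         arcs = Alpha ` {1, 2, 3} \<union> Beta ` {1, 2, 3} \<union> Gamma ` {1, 2, 3} \<union> Delta ` {1, 2, 3},
         tail = X7_tail,
         head = X7_head\<rparr>"

type_synonym 'k X7_series = "(nat, X7_arrow, 'k) path_series"

definition X7_B :: "nat \<Rightarrow> 'k::field X7_series" where
  "X7_B i = arrow_series X7 (Alpha i) \<otimes>\<^bsub>complete_path_algebra X7\<^esub>
     arrow_series X7 (Beta i) \<otimes>\<^bsub>complete_path_algebra X7\<^esub> arrow_series X7 (Gamma i)"

definition X7_Delta :: "nat \<Rightarrow> 'k::field X7_series" where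
  "X7_Delta i = arrow_series X7 (Alpha i) \<otimes>\<^bsub>complete_path_algebra X7\<^esub>
     arrow_series X7 (Delta i) \<otimes>\<^bsub>complete_path_algebra X7\<^esub> arrow_series X7 (Gamma i)"

definition X7_W0 :: "'k::field X7_series" where
  "X7_W0 = (let A = complete_path_algebra X7 in
     X7_B 1 \<oplus>\<^bsub>A\<^esub> X7_B 2 \<oplus>\<^bsub>A\<^esub> X7_B 3 \<oplus>\<^bsub>A\<^esub> X7_Delta 1 \<otimes>\<^bsub>A\<^esub> X7_Delta 2
       \<oplus>\<^bsub>A\<^esub> X7_Delta 2 \<otimes>\<^bsub>A\<^esub> X7_Delta 3 \<oplus>\<^bsub>A\<^esub> X7_Delta 3 \<otimes>\<^bsub>A\<^esub> X7_Delta 1)"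

definition X7_W1 :: "'k::field X7_series" where
  "X7_W1 = (let A = complete_path_algebra X7 in
     X7_W0 \<oplus>\<^bsub>A\<^esub> X7_Delta 1 \<otimes>\<^bsub>A\<^esub> X7_Delta 2 \<otimes>\<^bsub>A\<^esub> X7_Delta 3)"


section \<open>Well-definedness\<close>

lemma quiver_paths_take_drop:
  assumes "wf_digraph Q"
  shows "(u, p) \<in> quiver_paths Q \<longleftrightarrow> (u, take k p) \<in> quiver_paths Q \<and>
    (pre_digraph.awlast Q u (take k p), drop k p) \<in> quiver_paths Q"
proof -
  interpret wf_digraph Q by fact
  have "awalk u p v \<longleftrightarrow> awalk u (take k p) (awlast u (take k p)) \<and>
      awalk (awlast u (take k p)) (drop k p) v" for v
    using awalk_append_iff[of u "take k p" "drop k p" v] by simp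
  then show ?thesis
    unfolding quiver_paths_def using awalk_ends by blast
qed

lemma awlast_append:
  "pre_digraph.awlast Q u (p @ q) = pre_digraph.awlast Q (pre_digraph.awlast Q u p) q"
  by (simp add: pre_digraph.awalk_verts_conv)

lemma sum_triangle_swap:
  fixes F :: "nat \<Rightarrow> nat \<Rightarrow> 'b::comm_monoid_add"
  shows "(\<Sum>k\<le>n. \<Sum>j\<le>k. F j (k - j)) = (\<Sum>j\<le>n. \<Sum>i\<le>n - j. F j i)"
proof -
  have "(\<Sum>k\<le>n. \<Sum>j\<le>k. F j (k - j)) = (\<Sum>(k, j)\<in>(SIGMA k:{..n}. {..k}). F j (k - j))"
    by (simp add: sum.Sigma)
  also have "\<dots> = (\<Sum>(j, i)\<in>(SIGMA j:{..n}. {..n - j}). F j i)"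
    by (rule sum.reindex_bij_witness[of _ "\<lambda>(j, i). (i + j, j)" "\<lambda>(k, j). (j, k - j)"]) auto
  also have "\<dots> = (\<Sum>j\<le>n. \<Sum>i\<le>n - j. F j i)"
    by (simp add: sum.Sigma)
  finally show ?thesis .
qed

lemma path_series_mult_assoc:
  "path_series_mult Q (path_series_mult Q f g) h = path_series_mult Q f (path_series_mult Q g h)"
proof (rule ext, clarify)
  fix u p
  let ?l = "pre_digraph.awlast Q"
  define F where "F j i = f (u, take j p) * g (?l u (take j p), take i (drop j p)) *
      h (?l u (take (i + j) p), drop (i + j) p)" for j i
  have "path_series_mult Q (path_series_mult Q f g) h (u, p) =
      (\<Sum>k\<le>length p. \<Sum>j\<le>k. F j (k - j))"
    unfolding path_series_mult_def F_def
    by (auto simp: sum_distrib_right drop_take min_def intro!: sum.cong)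
  also have "\<dots> = (\<Sum>j\<le>length p. \<Sum>i\<le>length p - j. F j i)"
    by (rule sum_triangle_swap)
  also have "\<dots> = path_series_mult Q f (path_series_mult Q g h) (u, p)"
  proof -
    have "?l u (take (i + j) p) = ?l (?l u (take j p)) (take i (drop j p))" for i j
      using awlast_append[of Q u "take j p" "take i (drop j p)"]
      by (metis add.commute take_add)
    then show ?thesis
      unfolding path_series_mult_def F_def
      by (auto simp: sum_distrib_left mult.assoc intro!: sum.cong)
  qed
  finally show "path_series_mult Q (path_series_mult Q f g) h (u, p) =
      path_series_mult Q f (path_series_mult Q g h) (u, p)" .
qed

lemma path_series_scalar_mult:
  assumes "wf_digraph Q" "f \<in> carrier (complete_path_algebra Q)"
  shows "path_series_mult Q (path_series_scalar Q c) f = (\<lambda>s. c * f s)"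
    and "path_series_mult Q f (path_series_scalar Q c) = (\<lambda>s. f s * c)"
proof -
  interpret wf_digraph Q by fact
  have f0: "f s = 0" if "s \<notin> quiver_paths Q" for s
    using assms(2) that by (cases s) (simp add: complete_path_algebra_def)
  have hd: "f (u, p) = 0" if "u \<notin> verts Q" for u p
    using that f0[of "(u, p)"] by (auto simp: quiver_paths_def)
  have lst: "f (u, p) = 0" if "awlast u p \<notin> verts Q" for u p
  proof (rule f0)
    show "(u, p) \<notin> quiver_paths Q"
      using that by (auto simp: quiver_paths_def elim!: awalkE')
  qed
  show "path_series_mult Q (path_series_scalar Q c) f = (\<lambda>s. c * f s)"
  proof (rule ext, clarify)
    fix u p
    have "path_series_mult Q (path_series_scalar Q c) f (u, p) =
        (\<Sum>k\<in>{0}. path_series_scalar Q c (u, take k p) * f (awlast u (take k p), drop k p))"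
      unfolding path_series_mult_def prod.case
      by (rule sum.mono_neutral_right) (auto simp: path_series_scalar_def)
    also have "\<dots> = c * f (u, p)"
      using hd by (auto simp: path_series_scalar_def)
    finally show "path_series_mult Q (path_series_scalar Q c) f (u, p) = c * f (u, p)" .
  qed
  show "path_series_mult Q f (path_series_scalar Q c) = (\<lambda>s. f s * c)"
  proof (rule ext, clarify)
    fix u p
    have "path_series_mult Q f (path_series_scalar Q c) (u, p) =
        (\<Sum>k\<in>{length p}. f (u, take k p) * path_series_scalar Q c (awlast u (take k p), drop k p))"
      unfolding path_series_mult_def prod.case
      by (rule sum.mono_neutral_right) (auto simp: path_series_scalar_def)
    also have "\<dots> = f (u, p) * c"
      using lst[of u p] by (auto simp: path_series_scalar_def)
    finally show "path_series_mult Q f (path_series_scalar Q c) (u, p) = f (u, p) * c" .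
  qed
qed

lemma path_series_scalar_carrier:
  assumes "wf_digraph Q"
  shows "path_series_scalar Q c \<in> carrier (complete_path_algebra Q)"
proof -
  interpret wf_digraph Q by fact
  have "awalk u [] u" if "u \<in> verts Q" for u
    using that by (simp add: awalk_Nil_iff)
  then show ?thesis
    by (auto simp: complete_path_algebra_def path_series_scalar_def quiver_paths_def)
qed

lemma ring_complete_path_algebra:
  assumes Q: "wf_digraph Q"
  shows "ring (complete_path_algebra Q :: ('v, 'a, 'k::field) path_series ring)"
proof (rule ringI)
  let ?A = "complete_path_algebra Q :: ('v, 'a, 'k) path_series ring"
  show "abelian_group ?A"
  proof (rule abelian_groupI)
    show "\<exists>y\<in>carrier ?A. y \<oplus>\<^bsub>?A\<^esub> x = \<zero>\<^bsub>?A\<^esub>" if "x \<in> carrier ?A" for x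
      using that by (intro bexI[of _ "\<lambda>s. - x s"]) (auto simp: complete_path_algebra_def)
  qed (auto simp: complete_path_algebra_def add_ac)
  show "Group.monoid ?A"
  proof (rule monoidI)
    show "x \<otimes>\<^bsub>?A\<^esub> y \<in> carrier ?A" if "x \<in> carrier ?A" "y \<in> carrier ?A" for x y
    proof -
      have "path_series_mult Q x y (u, p) = 0" if np: "(u, p) \<notin> quiver_paths Q" for u p
      proof -
        have "x (u, take k p) * y (pre_digraph.awlast Q u (take k p), drop k p) = 0" for k
          using np quiver_paths_take_drop[OF Q, of u p k] \<open>x \<in> _\<close> \<open>y \<in> _\<close>
          by (auto simp: complete_path_algebra_def)
        then show ?thesis unfolding path_series_mult_def prod.case by (intro sum.neutral) blast
      qed
      then show ?thesis by (auto simp: complete_path_algebra_def)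
    qed
    show "\<one>\<^bsub>?A\<^esub> \<in> carrier ?A"
      using path_series_scalar_carrier[OF Q, of 1] by (simp add: complete_path_algebra_def)
    show "x \<otimes>\<^bsub>?A\<^esub> y \<otimes>\<^bsub>?A\<^esub> z = x \<otimes>\<^bsub>?A\<^esub> (y \<otimes>\<^bsub>?A\<^esub> z)" for x y z
      by (simp add: complete_path_algebra_def path_series_mult_assoc)
    show "\<one>\<^bsub>?A\<^esub> \<otimes>\<^bsub>?A\<^esub> x = x" "x \<otimes>\<^bsub>?A\<^esub> \<one>\<^bsub>?A\<^esub> = x" if "x \<in> carrier ?A" for x
      using path_series_scalar_mult[OF Q that, of 1] by (auto simp: complete_path_algebra_def)
  qed
qed (auto simp: complete_path_algebra_def path_series_mult_def algebra_simps sum.distrib)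

lemma cyclic_derivative_carrier:
  assumes Q: "wf_digraph Q"
  shows "cyclic_derivative Q a W \<in> carrier (complete_path_algebra Q)"
proof -
  interpret wf_digraph Q by fact
  have "(head Q a, drop (Suc i) c @ take i c) \<in> quiver_paths Q"
    if "(u, c) \<in> quiver_cycles Q" "i < length c" "c ! i = a" for u c i
  proof -
    have "awalk u (take i c @ a # drop (Suc i) c) u"
      using that id_take_nth_drop[of i c] by (auto simp: quiver_cycles_def)
    then have "awalk (head Q a) (drop (Suc i) c) u" "awalk u (take i c) (tail Q a)"
      by (auto simp: awalk_append_iff awalk_Cons_iff)
    then show ?thesis
      unfolding quiver_paths_def using awalk_appendI by blast
  qed
  then show ?thesis
    unfolding complete_path_algebra_def cyclic_derivative_def
    by (auto intro!: sum.neutral)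
qed

lemma ideal_path_series_closure:
  fixes I :: "('v, 'a, 'k::field) path_series set"
  assumes Q: "wf_digraph Q" and I: "ideal I (complete_path_algebra Q)"
  shows "ideal (path_series_closure Q I) (complete_path_algebra Q)"
proof -
  let ?A = "complete_path_algebra Q :: ('v, 'a, 'k) path_series ring"
  interpret A: ring ?A by (rule ring_complete_path_algebra[OF Q])
  interpret I: ideal I ?A by (rule I)
  let ?eq = "\<lambda>n f g. \<forall>u p. length p < n \<longrightarrow> f (u, p) = g (u, p)"
  have mult_eq: "?eq n (f \<otimes>\<^bsub>?A\<^esub> g) (f' \<otimes>\<^bsub>?A\<^esub> g')" if "?eq n f f'" "?eq n g g'" for n f f' g g'
    using that
    by (auto simp: complete_path_algebra_def path_series_mult_def intro!: sum.cong)
  have uminus: "\<ominus>\<^bsub>?A\<^esub> f = (\<lambda>s. - f s)" if "f \<in> carrier ?A" for f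
    using that by (intro A.minus_equality) (auto simp: complete_path_algebra_def)
  show ?thesis
  proof (rule idealI)
    show "ring ?A" by (rule A.ring_axioms)
    show "subgroup (path_series_closure Q I) (add_monoid ?A)"
    proof (rule A.add.subgroupI)
      show "path_series_closure Q I \<subseteq> carrier ?A"
        by (auto simp: path_series_closure_def)
      show "path_series_closure Q I \<noteq> {}"
      proof -
        have "\<zero>\<^bsub>?A\<^esub> \<in> path_series_closure Q I"
          using A.zero_closed I.zero_closed unfolding path_series_closure_def by blast
        then show ?thesis by blast
      qed
    next
      fix f assume f: "f \<in> path_series_closure Q I"
      have "\<exists>g\<in>I. ?eq n (\<ominus>\<^bsub>?A\<^esub> f) g" for n
      proof -
        obtain g where g: "g \<in> I" "?eq n f g"
          using f unfolding path_series_closure_def by blast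
        then have "\<ominus>\<^bsub>?A\<^esub> g \<in> I" by simp
        moreover have "?eq n (\<ominus>\<^bsub>?A\<^esub> f) (\<ominus>\<^bsub>?A\<^esub> g)"
          using g f I.Icarr uminus by (auto simp: path_series_closure_def)
        ultimately show ?thesis by blast
      qed
      then show "\<ominus>\<^bsub>?A\<^esub> f \<in> path_series_closure Q I"
        using f unfolding path_series_closure_def by simp
    next
      fix f f' assume f: "f \<in> path_series_closure Q I" and f': "f' \<in> path_series_closure Q I"
      have "\<exists>g\<in>I. ?eq n (f \<oplus>\<^bsub>?A\<^esub> f') g" for n
      proof -
        obtain g g' where g: "g \<in> I" "?eq n f g" "g' \<in> I" "?eq n f' g'"
          using f f' unfolding path_series_closure_def by blast
        then have "g \<oplus>\<^bsub>?A\<^esub> g' \<in> I" by simp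
        moreover have "?eq n (f \<oplus>\<^bsub>?A\<^esub> f') (g \<oplus>\<^bsub>?A\<^esub> g')"
          using g by (auto simp: complete_path_algebra_def)
        ultimately show ?thesis by blast
      qed
      then show "f \<oplus>\<^bsub>?A\<^esub> f' \<in> path_series_closure Q I"
        using f f' unfolding path_series_closure_def by simp
    qed
  next
    fix f x assume f: "f \<in> path_series_closure Q I" and x: "x \<in> carrier ?A"
    have "\<exists>g\<in>I. ?eq n (x \<otimes>\<^bsub>?A\<^esub> f) g" "\<exists>g\<in>I. ?eq n (f \<otimes>\<^bsub>?A\<^esub> x) g" for n
    proof -
      obtain g where g: "g \<in> I" "?eq n f g"
        using f unfolding path_series_closure_def by blast
      show "\<exists>g\<in>I. ?eq n (x \<otimes>\<^bsub>?A\<^esub> f) g"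
        using I.I_l_closed[OF g(1) x] mult_eq[of n x x f g] g(2) by blast
      show "\<exists>g\<in>I. ?eq n (f \<otimes>\<^bsub>?A\<^esub> x) g"
        using I.I_r_closed[OF g(1) x] mult_eq[of n f g x x] g(2) by blast
    qed
    then show "x \<otimes>\<^bsub>?A\<^esub> f \<in> path_series_closure Q I" "f \<otimes>\<^bsub>?A\<^esub> x \<in> path_series_closure Q I"
      using f x unfolding path_series_closure_def by simp_all
  qed
qed

lemma ideal_jacobian_ideal:
  assumes "wf_digraph Q"
  shows "ideal (jacobian_ideal Q W) (complete_path_algebra Q)"
  unfolding jacobian_ideal_def
  by (intro ideal_path_series_closure assms ring.genideal_ideal ring_complete_path_algebra)
    (auto intro: cyclic_derivative_carrier[OF assms])

lemma ring_jacobian_algebra: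
  assumes "wf_digraph Q"
  shows "ring (jacobian_algebra Q W)"
  unfolding jacobian_algebra_def
  by (rule ideal.quotient_is_ring[OF ideal_jacobian_ideal[OF assms]])

lemma jacobian_ideal_no_constant_term:
  fixes W :: "('v, 'a, 'k::field) path_series"
  assumes Q: "wf_digraph Q" and W: "W \<in> potentials Q" and f: "f \<in> jacobian_ideal Q W"
  shows "f (u, []) = 0"
proof -
  let ?A = "complete_path_algebra Q :: ('v, 'a, 'k) path_series ring"
  interpret A: ring ?A by (rule ring_complete_path_algebra[OF Q])
  let ?M = "{g \<in> carrier ?A. \<forall>u. g (u, []) = 0}"
  have uminus: "\<ominus>\<^bsub>?A\<^esub> f = (\<lambda>s. - f s)" if "f \<in> carrier ?A" for f
    using that by (intro A.minus_equality) (auto simp: complete_path_algebra_def)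
  have "ideal ?M ?A"
  proof (rule idealI)
    show "ring ?A" by (rule A.ring_axioms)
    show "subgroup ?M (add_monoid ?A)"
    proof (rule A.add.subgroupI)
      have "\<zero>\<^bsub>?A\<^esub> \<in> ?M"
        using A.zero_closed by (auto simp: complete_path_algebra_def)
      then show "?M \<noteq> {}" by blast
    next
      fix f assume "f \<in> ?M"
      then show "\<ominus>\<^bsub>?A\<^esub> f \<in> ?M" using uminus[of f] A.a_inv_closed[of f] by simp
    next
      fix f g assume "f \<in> ?M" "g \<in> ?M"
      then show "f \<oplus>\<^bsub>?A\<^esub> g \<in> ?M" using A.a_closed[of f g]
        by (simp add: complete_path_algebra_def)
    qed auto
  next
    fix f x assume fx: "f \<in> ?M" "x \<in> carrier ?A"
    then have "(x \<otimes>\<^bsub>?A\<^esub> f) (u, []) = 0" "(f \<otimes>\<^bsub>?A\<^esub> x) (u, []) = 0" for u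
      by (auto simp: complete_path_algebra_def path_series_mult_def pre_digraph.awalk_verts_conv)
    with fx show "x \<otimes>\<^bsub>?A\<^esub> f \<in> ?M" "f \<otimes>\<^bsub>?A\<^esub> x \<in> ?M" by simp_all
  qed
  moreover have "{cyclic_derivative Q a W |a. a \<in> arcs Q} \<subseteq> ?M"
  proof -
    have "W (v, c) = 0" if "i < length c" "drop (Suc i) c @ take i c = []" for v c i
    proof -
      have "length c = 1" using that by (cases c) auto
      then show ?thesis using W unfolding potentials_def by force
    qed
    then have "cyclic_derivative Q a W (u, []) = 0" for a u
      unfolding cyclic_derivative_def by (auto intro!: sum.neutral)
    then show ?thesis using cyclic_derivative_carrier[OF Q] by blast
  qed
  ultimately have "Idl\<^bsub>?A\<^esub> {cyclic_derivative Q a W |a. a \<in> arcs Q} \<subseteq> ?M"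
    by (rule A.genideal_minimal)
  moreover obtain g where "g \<in> Idl\<^bsub>?A\<^esub> {cyclic_derivative Q a W |a. a \<in> arcs Q}"
      "\<forall>u p. length p < 1 \<longrightarrow> f (u, p) = g (u, p)"
    using f unfolding jacobian_ideal_def path_series_closure_def by blast
  ultimately show ?thesis by auto
qed

lemma subfield_jacobian_scalars:
  fixes W :: "('v, 'a, 'k::field) path_series"
  assumes Q: "wf_digraph Q" and ne: "verts Q \<noteq> {}" and W: "W \<in> potentials Q"
  shows "subfield (jacobian_scalars Q W) (jacobian_algebra Q W)"
proof -
  let ?A = "complete_path_algebra Q :: ('v, 'a, 'k) path_series ring"
  let ?J = "jacobian_ideal Q W"
  let ?K = "range (path_series_scalar Q :: 'k \<Rightarrow> _)"
  interpret A: ring ?A by (rule ring_complete_path_algebra[OF Q])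
  interpret J: ideal ?J ?A by (rule ideal_jacobian_ideal[OF Q])
  obtain u where u: "u \<in> verts Q" using ne by blast
  have zero: "\<zero>\<^bsub>?A\<^esub> = path_series_scalar Q 0" and one: "\<one>\<^bsub>?A\<^esub> = path_series_scalar Q 1"
    by (auto simp: complete_path_algebra_def path_series_scalar_def)
  have add: "path_series_scalar Q c \<oplus>\<^bsub>?A\<^esub> path_series_scalar Q d = path_series_scalar Q (c + d)" for c d
    by (auto simp: complete_path_algebra_def path_series_scalar_def)
  have mult: "path_series_scalar Q c \<otimes>\<^bsub>?A\<^esub> path_series_scalar Q d = path_series_scalar Q (c * d)" for c d
    using path_series_scalar_mult(1)[OF Q path_series_scalar_carrier[OF Q], of c d]
    by (auto simp: complete_path_algebra_def path_series_scalar_def)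
  have inj: "path_series_scalar Q c = path_series_scalar Q d \<longleftrightarrow> c = d" for c d :: 'k
    using u by (auto simp: path_series_scalar_def fun_eq_iff)
  have sub: "?K \<subseteq> carrier ?A" using path_series_scalar_carrier[OF Q] by blast
  have "field (?A\<lparr>carrier := ?K\<rparr>)"
  proof (rule cring.cring_fieldI2)
    show "cring (?A\<lparr>carrier := ?K\<rparr>)"
    proof (rule cringI)
      show "abelian_group (?A\<lparr>carrier := ?K\<rparr>)"
      proof (rule abelian_groupI)
        fix x assume "x \<in> carrier (?A\<lparr>carrier := ?K\<rparr>)"
        then obtain c where "x = path_series_scalar Q c" by auto
        then show "\<exists>y\<in>carrier (?A\<lparr>carrier := ?K\<rparr>).
            y \<oplus>\<^bsub>?A\<lparr>carrier := ?K\<rparr>\<^esub> x = \<zero>\<^bsub>?A\<lparr>carrier := ?K\<rparr>\<^esub>"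
          by (intro bexI[of _ "path_series_scalar Q (- c)"]) (auto simp: add zero)
      qed (auto simp: add zero add_ac)
      show "comm_monoid (?A\<lparr>carrier := ?K\<rparr>)"
        by (rule comm_monoidI) (auto simp: mult one mult_ac)
    qed (auto simp: add mult distrib_right)
    show "\<zero>\<^bsub>?A\<lparr>carrier := ?K\<rparr>\<^esub> \<noteq> \<one>\<^bsub>?A\<lparr>carrier := ?K\<rparr>\<^esub>"
      by (simp add: zero one inj)
    fix a assume a: "a \<in> carrier (?A\<lparr>carrier := ?K\<rparr>)" "a \<noteq> \<zero>\<^bsub>?A\<lparr>carrier := ?K\<rparr>\<^esub>"
    then obtain c where "a = path_series_scalar Q c" "c \<noteq> 0" by (auto simp: zero)
    then show "\<exists>b\<in>carrier (?A\<lparr>carrier := ?K\<rparr>).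
        a \<otimes>\<^bsub>?A\<lparr>carrier := ?K\<rparr>\<^esub> b = \<one>\<^bsub>?A\<lparr>carrier := ?K\<rparr>\<^esub>"
      by (intro bexI[of _ "path_series_scalar Q (inverse c)"]) (auto simp: mult one)
  qed
  then have K: "subfield ?K ?A" using sub by (rule A.subfield_iff)
  interpret h: ring_hom_ring ?A "?A Quot ?J" "(+>\<^bsub>?A\<^esub>) ?J" by (rule J.rcos_ring_hom_ring)
  have "\<one>\<^bsub>?A\<^esub> \<notin> ?J"
    using jacobian_ideal_no_constant_term[OF Q W, of "\<one>\<^bsub>?A\<^esub>" u] u
    by (auto simp: one path_series_scalar_def)
  then have "\<one>\<^bsub>?A Quot ?J\<^esub> \<noteq> \<zero>\<^bsub>?A Quot ?J\<^esub>"
    using J.a_rcos_self[OF A.one_closed] unfolding FactRing_def by force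
  from h.img_is_subfield(2)[OF K this] show ?thesis
    by (simp add: jacobian_scalars_def jacobian_algebra_def image_image)
qed

lemma fin_digraph_X7: "fin_digraph X7"
  by unfold_locales (auto simp: X7_def)

lemma path_series_mult_single:
  assumes "pre_digraph.awlast Q u p = v"
  shows "path_series_mult Q (\<lambda>s. if s = (u, p) then 1 else 0) (\<lambda>s. if s = (v, q) then 1 else 0) =
    (\<lambda>s. if s = (u, p @ q) then 1 else (0::'k::field))"
proof (rule ext, clarify)
  fix w r
  have "path_series_mult Q (\<lambda>s. if s = (u, p) then 1 else 0) (\<lambda>s. if s = (v, q) then 1 else 0) (w, r) =
      (\<Sum>k\<le>length r. if k = length p \<and> (w, r) = (u, p @ q) then 1 else (0::'k))"
    unfolding path_series_mult_def prod.case
  proof (rule sum.cong)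
    fix k assume "k \<in> {..length r}"
    then have "(w = u \<and> take k r = p \<and> pre_digraph.awlast Q w (take k r) = v \<and> drop k r = q) \<longleftrightarrow>
        k = length p \<and> w = u \<and> r = p @ q"
      using assms by (auto simp: min_def)
    then show "(if (w, take k r) = (u, p) then 1 else 0) *
        (if (pre_digraph.awlast Q w (take k r), drop k r) = (v, q) then 1 else 0) =
        (if k = length p \<and> (w, r) = (u, p @ q) then 1 else (0::'k))"
      by auto
  qed simp
  also have "\<dots> = (if (w, r) = (u, p @ q) then 1 else 0)"
    by auto
  finally show "path_series_mult Q (\<lambda>s. if s = (u, p) then 1 else 0)
      (\<lambda>s. if s = (v, q) then 1 else 0) (w, r) = (if (w, r) = (u, p @ q) then 1 else (0::'k))" .
qed

lemma X7_B_eq: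
  "X7_B i = (\<lambda>s. if s = (0, [Alpha i, Beta i, Gamma i]) then 1 else (0::'k::field))"
  unfolding X7_B_def complete_path_algebra_def arrow_series_def
  by (simp add: path_series_mult_single X7_def pre_digraph.awalk_verts_conv)

lemma X7_Delta_eq:
  "X7_Delta i = (\<lambda>s. if s = (0, [Alpha i, Delta i, Gamma i]) then 1 else (0::'k::field))"
  unfolding X7_Delta_def complete_path_algebra_def arrow_series_def
  by (simp add: path_series_mult_single X7_def pre_digraph.awalk_verts_conv)

lemma X7_potentials: "X7_W0 \<in> potentials X7" "X7_W1 \<in> potentials X7"
  unfolding X7_W1_def X7_W0_def X7_B_eq X7_Delta_eq Let_def potentials_def complete_path_algebra_def
  by (auto simp: path_series_mult_single X7_def pre_digraph.awalk_verts_conv quiver_cycles_def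
      pre_digraph.awalk_def pre_digraph.cas.simps split: if_splits)

end

theory Submission
  imports Defs
begin

text \<open>
  Write \<open>a, b, c\<close> for the classes of \<open>\<Delta>\<^sub>1, \<Delta>\<^sub>2, \<Delta>\<^sub>3\<close> and consider \<open>W\<^sub>0 + t \<Delta>\<^sub>1\<Delta>\<^sub>2\<Delta>\<^sub>3\<close>.  The derivatives give
  \<open>a\<^sup>2 = b\<^sup>2 = c\<^sup>2 = 0\<close>, that \<open>a\<close> commutes with \<open>b + c + tbc\<close> (and cyclically), and
  \<open>B\<^sub>1 = - a (b + c + tbc)\<close>.  Hence modulo longer paths a long path is a word in \<open>a, b, c\<close> between
  two short pieces, and the algebra is finite-dimensional as soon as, for some \<open>k\<close>, all words of
  length \<open>k\<close> lie in the Jacobian ideal up to longer paths.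

  If \<open>2\<close> is invertible, this holds for \<open>k = 5\<close>: only the quadratic parts of the relations matter,
  and all words \<open>xyxy\<close> with \<open>x \<noteq> y\<close> agree while the other words of length 4 are multiples of them,
  so a word of length 5 starting with \<open>v\<close> is a multiple of \<open>v vyvy = 0\<close>.

  In characteristic 2 with \<open>t = 1\<close>, the elements \<open>A = 1 + a\<close>, \<open>B = 1 + b\<close>, \<open>C = 1 + c\<close> are involutions
  and the relations say \<open>ABC = BCA = CAB\<close>.  So \<open>g = ABC\<close> is central, \<open>AB = g\<^sup>2BA\<close> and \<open>g\<^sup>4 = 1\<close>.  With
  the central element \<open>k = 1 + g\<^sup>2\<close>, \<open>k\<^sup>2 = 0\<close>, all commutators of \<open>a, b, c\<close> are multiples of \<open>k\<close>,
  so that words of length 4 are multiples of \<open>k\<close> and words of length 8 vanish.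

  In characteristic 2 with \<open>t = 0\<close>, the matrices \<open>E\<^sub>1\<^sub>2\<close>, \<open>E\<^sub>2\<^sub>1\<close> and the all-ones matrix satisfy the
  relations for \<open>a, b, c\<close>.  The relations are homogeneous if \<open>\<beta>\<^sub>i\<close> has degree 4 and the other arrows
  have degree 1, so the powers of \<open>ab\<close>, which are mapped to \<open>E\<^sub>1\<^sub>1\<close>, are linearly independent.
\<close>

section \<open>Series of high order and finite-dimensionality\<close>

definition path_monomial :: "'v \<Rightarrow> 'a list \<Rightarrow> ('v, 'a, 'k::field) path_series" where
  "path_monomial u p = (\<lambda>s. if s = (u, p) then 1 else 0)"

text \<open>The basic neighbourhoods of 0 in the arrow ideal topology. Adding one of them to an
  ideal \<open>I\<close> expresses membership in \<open>I\<close> up to paths of length at least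
  \<open>n\<close>.\<close>

definition order_ideal :: "('v, 'a) pre_digraph \<Rightarrow> nat \<Rightarrow> ('v, 'a, 'k::field) path_series set" where
  "order_ideal Q n = {f \<in> carrier (complete_path_algebra Q). \<forall>u p. length p < n \<longrightarrow> f (u, p) = 0}"

lemma complete_path_algebra_simps:
  "f \<oplus>\<^bsub>complete_path_algebra Q\<^esub> g = (\<lambda>s. f s + g s)"
  "\<zero>\<^bsub>complete_path_algebra Q\<^esub> = (\<lambda>_. 0)"
  "\<one>\<^bsub>complete_path_algebra Q\<^esub> = path_series_scalar Q 1"
  "f \<otimes>\<^bsub>complete_path_algebra Q\<^esub> g = path_series_mult Q f g"
  by (simp_all add: complete_path_algebra_def)

lemma complete_path_algebra_carrier:
  "f \<in> carrier (complete_path_algebra Q) \<longleftrightarrow> (\<forall>s. s \<notin> quiver_paths Q \<longrightarrow> f s = 0)"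
  by (simp add: complete_path_algebra_def)

lemma complete_path_algebra_uminus:
  assumes "wf_digraph Q" "f \<in> carrier (complete_path_algebra Q)"
  shows "\<ominus>\<^bsub>complete_path_algebra Q\<^esub> f = (\<lambda>s. - f s)"
proof -
  interpret ring "complete_path_algebra Q" by (rule ring_complete_path_algebra[OF assms(1)])
  show ?thesis using assms(2) by (intro minus_equality) (auto simp: complete_path_algebra_def)
qed

lemma path_monomial_carrier:
  assumes "(u, p) \<in> quiver_paths Q"
  shows "path_monomial u p \<in> carrier (complete_path_algebra Q)"
  using assms by (auto simp: complete_path_algebra_carrier path_monomial_def)

lemma path_monomial_mult:
  assumes "pre_digraph.awlast Q u p = v"
  shows "path_monomial u p \<otimes>\<^bsub>complete_path_algebra Q\<^esub> path_monomial v q = path_monomial u (p @ q)"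
  using path_series_mult_single[OF assms, of q]
  by (simp add: complete_path_algebra_simps path_monomial_def)

lemma finite_quiver_paths:
  assumes "fin_digraph Q"
  shows "finite {s \<in> quiver_paths Q. length (snd s) \<le> n}"
proof -
  interpret fin_digraph Q by fact
  have "{s \<in> quiver_paths Q. length (snd s) \<le> n} \<subseteq> verts Q \<times> {p. set p \<subseteq> arcs Q \<and> length p \<le> n}"
    by (auto simp: quiver_paths_def awalk_def)
  moreover have "finite (verts Q \<times> {p. set p \<subseteq> arcs Q \<and> length p \<le> n})"
    by (intro finite_cartesian_product finite_lists_length_le finite_arcs finite_verts)
  ultimately show ?thesis by (rule finite_subset)
qed

text \<open>A series with finite support is a finite linear combination of monomials. The set
  \<open>H\<close> is arbitrary so that the induction serves both for membership in an ideal and for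
  membership of a class in a span.\<close>

lemma path_series_restrict_induct:
  assumes "finite S" and "(\<lambda>_. 0) \<in> H"
    and "\<And>g c s. s \<in> S \<Longrightarrow> g \<in> H \<Longrightarrow> (\<lambda>r. c * path_monomial (fst s) (snd s) r + g r) \<in> H"
  shows "(\<lambda>s. if s \<in> S then f s else (0::'k::field)) \<in> H"
  using assms
proof (induction S rule: finite_induct)
  case (insert s S)
  have "(\<lambda>r. f s * path_monomial (fst s) (snd s) r + (if r \<in> S then f r else 0)) \<in> H"
    using insert by simp
  also have "(\<lambda>r. f s * path_monomial (fst s) (snd s) r + (if r \<in> S then f r else 0)) =
      (\<lambda>r. if r \<in> insert s S then f r else 0)"
    using insert.hyps by (auto simp: path_monomial_def fun_eq_iff)
  finally show ?case .
qed simp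

text \<open>When a path shorter than \<open>m + n\<close> is cut in two, the first piece is shorter
  than \<open>m\<close> or the second shorter than \<open>n\<close>, so every summand of the
  convolution vanishes.\<close>

lemma order_ideal_mult:
  fixes f g :: "('v, 'a, 'k::field) path_series"
  assumes "wf_digraph Q" "f \<in> order_ideal Q m" "g \<in> order_ideal Q n"
  shows "f \<otimes>\<^bsub>complete_path_algebra Q\<^esub> g \<in> order_ideal Q (m + n)"
proof -
  interpret ring "complete_path_algebra Q :: ('v, 'a, 'k) path_series ring"
    by (rule ring_complete_path_algebra[OF assms(1)])
  have "f (u, take k p) * g (pre_digraph.awlast Q u (take k p), drop k p) = 0"
    if "length p < m + n" for u p k
  proof -
    have "length (take k p) < m \<or> length (drop k p) < n" using that by auto
    then show ?thesis using assms by (auto simp: order_ideal_def)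
  qed
  then have "(f \<otimes>\<^bsub>complete_path_algebra Q\<^esub> g) (u, p) = 0" if "length p < m + n" for u p
    using that unfolding complete_path_algebra_simps path_series_mult_def prod.case
    by (intro sum.neutral) blast
  then show ?thesis using assms by (simp add: order_ideal_def)
qed

lemma order_ideal_0: "order_ideal Q 0 = carrier (complete_path_algebra Q)"
  by (simp add: order_ideal_def)

lemma ideal_order_ideal:
  assumes "wf_digraph Q"
  shows "ideal (order_ideal Q n :: ('v, 'a, 'k::field) path_series set) (complete_path_algebra Q)"
proof -
  let ?A = "complete_path_algebra Q :: ('v, 'a, 'k) path_series ring"
  let ?F = "order_ideal Q n :: ('v, 'a, 'k) path_series set"
  interpret ring ?A
    by (rule ring_complete_path_algebra[OF assms])
  show ?thesis
  proof (rule idealI)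
    show "ring ?A" by (rule ring_axioms)
    show "subgroup (?F) (add_monoid ?A)"
    proof (rule add.subgroupI)
      show "?F \<noteq> {}"
        using zero_closed by (force simp: order_ideal_def complete_path_algebra_simps)
    next
      fix f assume f: "f \<in> ?F"
      then show "\<ominus>\<^bsub>?A\<^esub> f \<in> ?F"
        using complete_path_algebra_uminus[OF assms, of f] a_inv_closed[of f]
        by (simp add: order_ideal_def)
    next
      fix f g assume "f \<in> ?F" "g \<in> ?F"
      then show "f \<oplus>\<^bsub>?A\<^esub> g \<in> ?F"
        using a_closed[of f g] by (simp add: order_ideal_def complete_path_algebra_simps)
    qed (auto simp: order_ideal_def)
  next
    fix f x :: "('v, 'a, 'k) path_series"
    assume "f \<in> ?F" "x \<in> carrier ?A"
    then show "x \<otimes>\<^bsub>?A\<^esub> f \<in> ?F"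
      "f \<otimes>\<^bsub>?A\<^esub> x \<in> ?F"
      using order_ideal_mult[OF assms, of x 0 f n] order_ideal_mult[OF assms, of f n x 0]
      by (simp_all add: order_ideal_0)
  qed
qed

lemma path_monomial_order_ideal:
  assumes "(u, p) \<in> quiver_paths Q" "n \<le> length p"
  shows "path_monomial u p \<in> order_ideal Q n"
  using assms path_monomial_carrier[OF assms(1)] by (auto simp: order_ideal_def path_monomial_def)

lemma order_ideal_add_iff:
  fixes I :: "('v, 'a, 'k::field) path_series set"
  assumes Q: "wf_digraph Q" and I: "ideal I (complete_path_algebra Q)"
  shows "f \<in> I <+>\<^bsub>complete_path_algebra Q\<^esub> order_ideal Q n \<longleftrightarrow>
    f \<in> carrier (complete_path_algebra Q) \<and>
    (\<exists>g\<in>I. \<forall>u p. length p < n \<longrightarrow> f (u, p) = g (u, p))"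
proof -
  interpret I: ideal I "complete_path_algebra Q" by fact
  interpret F: ideal "order_ideal Q n" "complete_path_algebra Q :: ('v, 'a, 'k) path_series ring"
    by (rule ideal_order_ideal[OF Q])
  show ?thesis
  proof
    assume "f \<in> I <+>\<^bsub>complete_path_algebra Q\<^esub> order_ideal Q n"
    then obtain g h where gh: "g \<in> I" "h \<in> order_ideal Q n" "f = g \<oplus>\<^bsub>complete_path_algebra Q\<^esub> h"
      unfolding set_add_def' by blast
    then have "f \<in> carrier (complete_path_algebra Q)" using I.Icarr F.Icarr by blast
    moreover have "\<forall>u p. length p < n \<longrightarrow> f (u, p) = g (u, p)"
      using gh(2) unfolding gh(3) complete_path_algebra_simps order_ideal_def by auto
    ultimately show "f \<in> carrier (complete_path_algebra Q) \<and>
      (\<exists>g\<in>I. \<forall>u p. length p < n \<longrightarrow> f (u, p) = g (u, p))" using gh(1) by blast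
  next
    assume "f \<in> carrier (complete_path_algebra Q) \<and>
      (\<exists>g\<in>I. \<forall>u p. length p < n \<longrightarrow> f (u, p) = g (u, p))"
    then obtain g where f: "f \<in> carrier (complete_path_algebra Q)" and g: "g \<in> I"
      and eq: "\<forall>u p. length p < n \<longrightarrow> f (u, p) = g (u, p)" by blast
    have "(\<lambda>s. f s - g s) \<in> order_ideal Q n"
      using f I.Icarr[OF g] eq by (auto simp: order_ideal_def complete_path_algebra_carrier)
    moreover have "f = g \<oplus>\<^bsub>complete_path_algebra Q\<^esub> (\<lambda>s. f s - g s)"
      by (simp add: complete_path_algebra_simps)
    ultimately show "f \<in> I <+>\<^bsub>complete_path_algebra Q\<^esub> order_ideal Q n"
      using g unfolding set_add_def' by blast
  qed
qed

lemma ideal_add_order_ideal: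
  assumes "wf_digraph Q" "ideal I (complete_path_algebra Q)"
  shows "ideal (I <+>\<^bsub>complete_path_algebra Q\<^esub> order_ideal Q n) (complete_path_algebra Q)"
  using ring.add_ideals[OF ring_complete_path_algebra[OF assms(1)] assms(2) ideal_order_ideal[OF assms(1)]] .

lemma path_series_closure_iff:
  assumes Q: "wf_digraph Q" and I: "ideal I (complete_path_algebra Q)"
  shows "f \<in> path_series_closure Q I \<longleftrightarrow>
    (\<forall>n. f \<in> I <+>\<^bsub>complete_path_algebra Q\<^esub> order_ideal Q n)"
  unfolding order_ideal_add_iff[OF assms] path_series_closure_def by blast

text \<open>Successive approximation: the part of lowest degree is replaced, modulo
  \<open>I\<close>, by longer paths, and this is iterated. The closure asks for an approximation for
  each \<open>n\<close> separately, so no limit has to be formed.\<close>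

lemma order_ideal_subset_closure:
  fixes I :: "('v, 'a, 'k::field) path_series set"
  assumes Q: "fin_digraph Q" and I: "ideal I (complete_path_algebra Q)"
    and long: "\<And>u p. (u, p) \<in> quiver_paths Q \<Longrightarrow> N \<le> length p \<Longrightarrow>
      path_monomial u p \<in> I <+>\<^bsub>complete_path_algebra Q\<^esub> order_ideal Q (Suc (length p))"
  shows "order_ideal Q N \<subseteq> path_series_closure Q I"
proof
  let ?A = "complete_path_algebra Q :: ('v, 'a, 'k) path_series ring"
  interpret Q: fin_digraph Q by fact
  have wf: "wf_digraph Q" by unfold_locales
  interpret A: ring ?A by (rule ring_complete_path_algebra[OF wf])
  interpret I: ideal I ?A by fact
  let ?J = "\<lambda>n. I <+>\<^bsub>?A\<^esub> order_ideal Q n"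
  have graded: "f \<in> ?J (Suc n)" if f: "f \<in> order_ideal Q n" and n: "N \<le> n" for f n
  proof -
    interpret J: ideal "?J (Suc n)" ?A by (rule ideal_add_order_ideal[OF wf I])
    \<comment> \<open>Only the homogeneous part of degree \<open>n\<close> has to be treated; since
      the quiver is finite, it is a finite combination of monomials.\<close>
    define S where "S = {s \<in> quiver_paths Q. length (snd s) = n}"
    have fin: "finite S"
      by (rule finite_subset[OF _ finite_quiver_paths[OF Q, of n]]) (auto simp: S_def)
    have "(\<lambda>s. if s \<in> S then f s else 0) \<in> ?J (Suc n)"
    proof (rule path_series_restrict_induct[OF fin])
      show "(\<lambda>_. 0) \<in> ?J (Suc n)" using J.zero_closed by (simp add: complete_path_algebra_simps)
    next
      fix g c s assume s: "s \<in> S" and g: "g \<in> ?J (Suc n)"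
      have m: "path_monomial (fst s) (snd s) \<in> ?J (Suc n)"
        using long[of "fst s" "snd s"] s n by (simp add: S_def)
      have "path_series_scalar Q c \<otimes>\<^bsub>?A\<^esub> path_monomial (fst s) (snd s) \<oplus>\<^bsub>?A\<^esub> g \<in> ?J (Suc n)"
        using J.I_l_closed[OF m path_series_scalar_carrier[OF wf]] g by (rule J.a_closed)
      then show "(\<lambda>r. c * path_monomial (fst s) (snd s) r + g r) \<in> ?J (Suc n)"
        using path_series_scalar_mult(1)[OF wf J.Icarr[OF m]]
        by (simp add: complete_path_algebra_simps)
    qed
    then obtain g where g: "g \<in> I"
      "\<forall>u p. length p < Suc n \<longrightarrow> (if (u, p) \<in> S then f (u, p) else 0) = g (u, p)"
      unfolding order_ideal_add_iff[OF wf I] by blast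
    have "f (u, p) = g (u, p)" if "length p < Suc n" for u p
      using f g(2)[rule_format, OF that, of u] that
      by (cases "length p = n") (auto simp: order_ideal_def complete_path_algebra_carrier S_def split: if_splits)
    moreover have "f \<in> carrier ?A" using f by (simp add: order_ideal_def)
    ultimately show ?thesis using g(1) unfolding order_ideal_add_iff[OF wf I] by blast
  qed
  fix f :: "('v, 'a, 'k) path_series" assume f: "f \<in> order_ideal Q N"
  have le: "f \<in> ?J n" if "N \<le> n" for n
    using that
  proof (induction n rule: dec_induct)
    case base
    have "f = \<zero>\<^bsub>?A\<^esub> \<oplus>\<^bsub>?A\<^esub> f" by (simp add: complete_path_algebra_simps)
    then show ?case using f I.zero_closed unfolding set_add_def' by blast
  next
    case (step n)
    then obtain g h where gh: "g \<in> I" "h \<in> order_ideal Q n" "f = g \<oplus>\<^bsub>?A\<^esub> h"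
      unfolding set_add_def' by blast
    interpret J: ideal "?J (Suc n)" ?A by (rule ideal_add_order_ideal[OF wf I])
    have "g \<in> ?J (Suc n)"
      using gh(1) I.Icarr unfolding order_ideal_add_iff[OF wf I] by blast
    then show ?case using gh graded[OF gh(2)] step.hyps J.a_closed by simp
  qed
  show "f \<in> path_series_closure Q I"
    unfolding path_series_closure_iff[OF wf I]
  proof
    fix n
    \<comment> \<open>The induction started at \<open>N\<close>; below \<open>N\<close> the
      approximation for \<open>N\<close> itself serves.\<close>
    have "f \<in> ?J (max n N)" using le by simp
    then obtain g where "f \<in> carrier ?A" "g \<in> I" "\<forall>u p. length p < max n N \<longrightarrow> f (u, p) = g (u, p)"
      unfolding order_ideal_add_iff[OF wf I] by blast
    then show "f \<in> ?J n" unfolding order_ideal_add_iff[OF wf I] by (intro conjI bexI[of _ g]) simp_all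
  qed
qed

lemma path_series_mult_add:
  "path_series_mult Q f (\<lambda>s. g s + h s) = (\<lambda>s. path_series_mult Q f g s + path_series_mult Q f h s)"
  "path_series_mult Q (\<lambda>s. g s + h s) f = (\<lambda>s. path_series_mult Q g f s + path_series_mult Q h f s)"
  "path_series_mult Q f (\<lambda>s. g s - h s) = (\<lambda>s. path_series_mult Q f g s - path_series_mult Q f h s)"
  "path_series_mult Q (\<lambda>s. g s - h s) f = (\<lambda>s. path_series_mult Q g f s - path_series_mult Q h f s)"
  by (auto simp: path_series_mult_def algebra_simps sum.distrib sum_subtractf)

lemma path_series_mult_smult:
  "path_series_mult Q f (\<lambda>s. c * g s) = (\<lambda>s. c * path_series_mult Q f g s)"
  "path_series_mult Q (\<lambda>s. c * g s) f = (\<lambda>s. c * path_series_mult Q g f s)"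
  by (auto simp: path_series_mult_def algebra_simps sum_distrib_left)

lemma ideal_minus_closed:
  assumes "ideal J (complete_path_algebra Q)" "wf_digraph Q" "f \<in> J" "g \<in> J"
  shows "(\<lambda>s. f s - g s) \<in> J"
proof -
  interpret ideal J "complete_path_algebra Q" by fact
  have "f \<oplus>\<^bsub>complete_path_algebra Q\<^esub> (\<ominus>\<^bsub>complete_path_algebra Q\<^esub> g) \<in> J"
    using a_subgroup assms(3,4) by (simp add: a_closed additive_subgroup.a_inv_closed[OF additive_subgroup_axioms])
  then show ?thesis
    using complete_path_algebra_uminus[OF assms(2) Icarr[OF assms(4)]]
    by (simp add: complete_path_algebra_simps)
qed

lemma ideal_mult_closed:
  assumes "ideal J (complete_path_algebra Q)" "f \<in> J" "g \<in> carrier (complete_path_algebra Q)"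
  shows "path_series_mult Q g f \<in> J" "path_series_mult Q f g \<in> J"
  using ideal.I_l_closed[OF assms] ideal.I_r_closed[OF assms] by (simp_all add: complete_path_algebra_simps)

text \<open>The part in \<open>I\<close> stays in \<open>I\<close> and the orders of the remaining
  factors add up. A relation valid up to longer paths thus stays valid inside a longer path, with
  the same gain in length.\<close>

lemma order_ideal_add_mult:
  fixes x g :: "('v, 'a, 'k::field) path_series"
  assumes Q: "wf_digraph Q" and I: "ideal I (complete_path_algebra Q)"
    and x: "x \<in> I <+>\<^bsub>complete_path_algebra Q\<^esub> order_ideal Q n" and g: "g \<in> order_ideal Q m"
  shows "path_series_mult Q g x \<in> I <+>\<^bsub>complete_path_algebra Q\<^esub> order_ideal Q (m + n)"
    "path_series_mult Q x g \<in> I <+>\<^bsub>complete_path_algebra Q\<^esub> order_ideal Q (n + m)"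
proof -
  obtain y z where y: "y \<in> I" and z: "z \<in> order_ideal Q n" and "x = y \<oplus>\<^bsub>complete_path_algebra Q\<^esub> z"
    using x unfolding set_add_def' by blast
  then have xe: "x = (\<lambda>s. y s + z s)" by (simp add: complete_path_algebra_simps)
  have "path_series_mult Q g x = path_series_mult Q g y \<oplus>\<^bsub>complete_path_algebra Q\<^esub> path_series_mult Q g z"
   "path_series_mult Q x g = path_series_mult Q y g \<oplus>\<^bsub>complete_path_algebra Q\<^esub> path_series_mult Q z g"
    unfolding xe by (simp_all add: complete_path_algebra_simps path_series_mult_add)
  moreover have "g \<in> carrier (complete_path_algebra Q)" using g by (simp add: order_ideal_def)
  note ideal_mult_closed[OF I y this]
  moreover have "path_series_mult Q g z \<in> order_ideal Q (m + n)" "path_series_mult Q z g \<in> order_ideal Q (n + m)"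
    using order_ideal_mult[OF Q g z] order_ideal_mult[OF Q z g] by (simp_all add: complete_path_algebra_simps)
  ultimately show "path_series_mult Q g x \<in> I <+>\<^bsub>complete_path_algebra Q\<^esub> order_ideal Q (m + n)"
    "path_series_mult Q x g \<in> I <+>\<^bsub>complete_path_algebra Q\<^esub> order_ideal Q (n + m)"
    unfolding set_add_def' by blast+
qed

lemma order_ideal_add_mono:
  assumes "wf_digraph Q" "ideal I (complete_path_algebra Q)" "m \<le> n"
    "f \<in> I <+>\<^bsub>complete_path_algebra Q\<^esub> order_ideal Q n"
  shows "f \<in> I <+>\<^bsub>complete_path_algebra Q\<^esub> order_ideal Q m"
proof -
  obtain g where "f \<in> carrier (complete_path_algebra Q)" "g \<in> I"
    "\<forall>u p. length p < n \<longrightarrow> f (u, p) = g (u, p)"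
    using assms(4) unfolding order_ideal_add_iff[OF assms(1,2)] by blast
  then show ?thesis
    unfolding order_ideal_add_iff[OF assms(1,2)]
    using assms(3) by (intro conjI bexI[of _ g]) simp_all
qed

lemma ideal_coset_eqI:
  assumes Q: "wf_digraph Q" and J: "ideal J (complete_path_algebra Q)"
    and "f \<in> carrier (complete_path_algebra Q)" "g \<in> carrier (complete_path_algebra Q)"
    and "(\<lambda>s. f s - g s) \<in> J"
  shows "J +>\<^bsub>complete_path_algebra Q\<^esub> f = J +>\<^bsub>complete_path_algebra Q\<^esub> g"
proof -
  interpret ring "complete_path_algebra Q" by (rule ring_complete_path_algebra[OF Q])
  have "f \<ominus>\<^bsub>complete_path_algebra Q\<^esub> g = (\<lambda>s. f s - g s)"
    unfolding a_minus_def complete_path_algebra_uminus[OF Q assms(4)]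
    by (simp add: complete_path_algebra_simps)
  then show ?thesis
    using quotient_eq_iff_same_a_r_cos[OF J assms(3,4)] assms(5) by simp
qed

text \<open>The classes of the finitely many paths of length at most \<open>N\<close> span, because
  what remains of a series after removing these paths lies in the Jacobian ideal.\<close>

lemma finite_dim_jacobian_algebraI:
  fixes W :: "('v, 'a, 'k::field) path_series"
  assumes Q: "fin_digraph Q" and ne: "verts Q \<noteq> {}" and W: "W \<in> potentials Q"
    and N: "order_ideal Q N \<subseteq> jacobian_ideal Q W"
  shows "finite_dim_jacobian_algebra Q W"
proof -
  let ?A = "complete_path_algebra Q :: ('v, 'a, 'k) path_series ring"
  let ?L = "jacobian_algebra Q W" and ?K = "jacobian_scalars Q W"
  interpret Q: fin_digraph Q by fact
  have wf: "wf_digraph Q" by unfold_locales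
  interpret A: ring ?A by (rule ring_complete_path_algebra[OF wf])
  interpret L: ring ?L by (rule ring_jacobian_algebra[OF wf])
  interpret J: ideal "jacobian_ideal Q W" ?A by (rule ideal_jacobian_ideal[OF wf])
  define h where "h = (+>\<^bsub>?A\<^esub>) (jacobian_ideal Q W)"
  interpret h: ring_hom_ring ?A ?L h
    unfolding jacobian_algebra_def h_def by (rule J.rcos_ring_hom_ring)
  have K: "subfield ?K ?L" by (rule subfield_jacobian_scalars[OF wf ne W])
  define S where "S = {s \<in> quiver_paths Q. length (snd s) \<le> N}"
  have fin: "finite S" unfolding S_def by (rule finite_quiver_paths[OF Q])
  then obtain ss where ss: "set ss = S" using finite_list by blast
  define Us where "Us = map (\<lambda>s. h (path_monomial (fst s) (snd s))) ss"
  have mc: "path_monomial (fst s) (snd s) \<in> carrier ?A" if "s \<in> S" for s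
    using that by (intro path_monomial_carrier) (simp add: S_def)
  have Us: "set Us \<subseteq> carrier ?L" using mc ss by (auto simp: Us_def)
  have in_Span: "h f \<in> L.Span ?K Us" if f: "f \<in> carrier ?A" for f
  proof -
    let ?H = "{g \<in> carrier ?A. h g \<in> L.Span ?K Us}"
    have r: "(\<lambda>s. if s \<in> S then f s else 0) \<in> ?H"
    proof (rule path_series_restrict_induct[OF fin])
      show "(\<lambda>_. 0) \<in> ?H"
        using A.zero_closed h.hom_zero L.Span_subgroup_props(2)[OF K Us]
        by (simp add: complete_path_algebra_simps del: h.hom_zero)
    next
      fix g c s assume s: "s \<in> S" and g: "g \<in> ?H"
      have sc: "path_series_scalar Q c \<in> carrier ?A" by (rule path_series_scalar_carrier[OF wf])
      have "h (path_monomial (fst s) (snd s)) \<in> L.Span ?K Us"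
        using L.Span_base_incl[OF K Us] s ss by (auto simp: Us_def)
      moreover have "h (path_series_scalar Q c) \<in> ?K" by (simp add: jacobian_scalars_def h_def)
      ultimately have "h (path_series_scalar Q c \<otimes>\<^bsub>?A\<^esub> path_monomial (fst s) (snd s) \<oplus>\<^bsub>?A\<^esub> g) \<in> L.Span ?K Us"
        using sc mc[OF s] g L.Span_smult_closed[OF K Us] L.Span_subgroup_props(3)[OF K Us] by simp
      moreover have "path_series_scalar Q c \<otimes>\<^bsub>?A\<^esub> path_monomial (fst s) (snd s) \<oplus>\<^bsub>?A\<^esub> g \<in> carrier ?A"
        using sc mc[OF s] g by simp
      ultimately show "(\<lambda>r. c * path_monomial (fst s) (snd s) r + g r) \<in> ?H"
        using path_series_scalar_mult(1)[OF wf mc[OF s], of c]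
        by (simp add: complete_path_algebra_simps)
    qed
    have "(\<lambda>s. if s \<in> S then 0 else f s) \<in> order_ideal Q N"
      using f by (auto simp: order_ideal_def complete_path_algebra_carrier S_def)
    then have n: "(\<lambda>s. if s \<in> S then 0 else f s) \<in> jacobian_ideal Q W" using N by blast
    have "h (\<lambda>s. if s \<in> S then 0 else f s) = \<zero>\<^bsub>?L\<^esub>"
      using J.a_rcos_const[OF n] by (simp add: h_def jacobian_algebra_def FactRing_def)
    moreover have "f = (\<lambda>s. if s \<in> S then f s else 0) \<oplus>\<^bsub>?A\<^esub> (\<lambda>s. if s \<in> S then 0 else f s)"
      by (auto simp: complete_path_algebra_simps)
    ultimately have "h f = h (\<lambda>s. if s \<in> S then f s else 0) \<oplus>\<^bsub>?L\<^esub> \<zero>\<^bsub>?L\<^esub>"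
      using r J.Icarr[OF n] h.hom_add by (metis (no_types, lifting) mem_Collect_eq)
    then show ?thesis using r by simp
  qed
  have "L.Span ?K Us = carrier ?L"
  proof (rule equalityI)
    show "L.Span ?K Us \<subseteq> carrier ?L" by (rule L.Span_subgroup_props(1)[OF K Us])
    have "carrier ?L = h ` carrier ?A"
      unfolding jacobian_algebra_def FactRing_def A_RCOSETS_defs h_def a_r_coset_def by auto
    then show "carrier ?L \<subseteq> L.Span ?K Us" using in_Span by (simp only: image_subset_iff) blast
  qed
  then show ?thesis
    unfolding finite_dim_jacobian_algebra_def
    using L.Span_finite_dimension[OF K Us] by (simp only:)
qed

section \<open>Cyclic derivatives of cycles\<close>

lemma cyclic_derivative_add:
  "cyclic_derivative Q a (\<lambda>s. V s + W s) = (\<lambda>s. cyclic_derivative Q a V s + cyclic_derivative Q a W s)"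
  by (simp add: cyclic_derivative_def sum.distrib split_def fun_eq_iff)

lemma cyclic_derivative_smult:
  "cyclic_derivative Q a (\<lambda>s. c * W s) = (\<lambda>s. c * cyclic_derivative Q a W s)"
  by (simp add: cyclic_derivative_def sum_distrib_left split_def fun_eq_iff)

text \<open>The defining sum runs over all cycles with a marked occurrence of \<open>a\<close>. Its
  index set must be shown finite first, because a sum over an infinite set is 0 by convention; then
  only the summands for \<open>c\<close> itself survive.\<close>

lemma cyclic_derivative_path_monomial:
  assumes Q: "fin_digraph Q" and cyc: "(u, c) \<in> quiver_cycles Q"
  shows "cyclic_derivative Q a (path_monomial u c) =
    (\<lambda>s. \<Sum>i<length c. if c ! i = a then path_monomial (head Q a) (drop (Suc i) c @ take i c) s else (0::'k::field))"
proof
  fix s :: "'a \<times> 'b list"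
  interpret fin_digraph Q by fact
  obtain h q where s: "s = (h, q)" by (cases s)
  define S where "S = {((u, c), i). (u, c) \<in> quiver_cycles Q \<and> i < length c \<and> c ! i = a \<and>
        (head Q a, drop (Suc i) c @ take i c) = s}"
  define I where "I = {i. i < length c \<and> c ! i = a \<and> (head Q a, drop (Suc i) c @ take i c) = s}"
  \<comment> \<open>Deletion and rotation are undone: the last \<open>i\<close> arrows of
    \<open>q\<close> stand before the marked arrow of the cycle, the others after it.\<close>
  let ?f = "\<lambda>(u, i). ((u, drop (length q - i) q @ a # take (length q - i) q), i)"
  have "S \<subseteq> ?f ` (verts Q \<times> {..length q})"
  proof
    fix x assume "x \<in> S"
    then obtain v d i where x: "x = ((v, d), i)" and "(v, d) \<in> quiver_cycles Q" and i: "i < length d"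
      and a: "d ! i = a" and q: "drop (Suc i) d @ take i d = q"
      unfolding S_def s by blast
    then have v: "v \<in> verts Q" by (auto simp: quiver_cycles_def)
    have "length q - i = length (drop (Suc i) d)" using i by (simp flip: q)
    then have "take (length q - i) q = drop (Suc i) d" "drop (length q - i) q = take i d"
      by (simp_all flip: q)
    moreover have "d = take i d @ d ! i # drop (Suc i) d" using i by (rule id_take_nth_drop)
    ultimately have "x = ?f (v, i)" using x a by simp
    moreover have "i \<le> length q" using i by (simp flip: q)
    ultimately show "x \<in> ?f ` (verts Q \<times> {..length q})" using v by blast
  qed
  then have "finite S" by (rule finite_subset) (intro finite_imageI finite_cartesian_product finite_verts finite_atMost)
  have "cyclic_derivative Q a (path_monomial u c) s = (\<Sum>x\<in>S. path_monomial u c (fst x))"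
    unfolding cyclic_derivative_def S_def by (rule sum.cong) (auto simp: split_def)
  also have "\<dots> = (\<Sum>x\<in>Pair (u, c) ` I. path_monomial u c (fst x))"
    using \<open>finite S\<close> cyc
    by (intro sum.mono_neutral_right) (auto simp: S_def I_def path_monomial_def)
  also have "\<dots> = (\<Sum>i\<in>I. 1)"
    by (subst sum.reindex) (auto simp: inj_on_def path_monomial_def)
  also have "\<dots> = (\<Sum>i<length c. if c ! i = a \<and> (head Q a, drop (Suc i) c @ take i c) = s then 1 else 0)"
    by (subst sum.inter_filter[symmetric]) (auto simp: I_def intro!: sum.cong)
  also have "\<dots> = (\<Sum>i<length c. if c ! i = a then path_monomial (head Q a) (drop (Suc i) c @ take i c) s else 0)"
    by (intro sum.cong) (auto simp: path_monomial_def)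
  finally show "cyclic_derivative Q a (path_monomial u c) s =
    (\<Sum>i<length c. if c ! i = a then path_monomial (head Q a) (drop (Suc i) c @ take i c) s else 0)" .
qed

section \<open>Nilpotency in the algebra generated by three square-zero elements\<close>

context ring
begin

lemma char2_add:
  assumes "\<one> \<oplus> \<one> = \<zero>" "x \<in> carrier R"
  shows "x \<oplus> x = \<zero>"
  by (metis assms l_distr l_null l_one one_closed)

text \<open>The hypotheses say that the three rotations of \<open>A B C\<close> coincide. Their
  common value \<open>g\<close> equals \<open>A (B C)\<close> and \<open>(B C) A\<close>, and
  likewise for the other letters, so it commutes with each of them. Replacing \<open>g B\<close> by
  \<open>C A\<close> and so on gives the exchange rules with factor \<open>g g\<close>.\<close>

lemma three_involutions_commutators:
  assumes A: "A \<in> carrier R" and B: "B \<in> carrier R" and C: "C \<in> carrier R"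
    and AA: "A \<otimes> A = \<one>" and BB: "B \<otimes> B = \<one>" and CC: "C \<otimes> C = \<one>"
    and comm: "A \<otimes> (B \<otimes> C) = B \<otimes> C \<otimes> A" "B \<otimes> (C \<otimes> A) = C \<otimes> A \<otimes> B"
  obtains g where "g \<in> carrier R"
    "\<And>X. X \<in> {A, B, C} \<Longrightarrow> X \<otimes> g = g \<otimes> X"
    "A \<otimes> B = g \<otimes> g \<otimes> (B \<otimes> A)" "B \<otimes> C = g \<otimes> g \<otimes> (C \<otimes> B)" "C \<otimes> A = g \<otimes> g \<otimes> (A \<otimes> C)"
    "g \<otimes> g \<otimes> (g \<otimes> g) = \<one>"
proof -
  define g where "g = A \<otimes> (B \<otimes> C)"
  have g: "g \<in> carrier R" using A B C by (simp add: g_def)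
  note car = A B C g
  have cancel: "X \<otimes> (X \<otimes> Y) = Y" if "X \<in> {A, B, C}" "Y \<in> carrier R" for X Y
    using that AA BB CC A B C by (auto simp: m_assoc[symmetric])
  have g2: "g = B \<otimes> (C \<otimes> A)" and g3: "g = C \<otimes> (A \<otimes> B)"
    using comm car by (auto simp: g_def m_assoc)
  have Ag: "A \<otimes> g = B \<otimes> C" and Bg: "B \<otimes> g = C \<otimes> A" and Cg: "C \<otimes> g = A \<otimes> B"
    using cancel[of A "B \<otimes> C"] cancel[of B "C \<otimes> A"] cancel[of C "A \<otimes> B"] car
    by (simp_all flip: g_def g2 g3)
  have gA: "g \<otimes> A = B \<otimes> C" using car AA by (simp add: g2 m_assoc)
  have gB: "g \<otimes> B = C \<otimes> A" using car BB by (simp add: g3 m_assoc)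
  have gC: "g \<otimes> C = A \<otimes> B" using car CC by (simp add: g_def m_assoc)
  have AB: "A \<otimes> B = g \<otimes> g \<otimes> (B \<otimes> A)"
  proof -
    have "g \<otimes> g \<otimes> (B \<otimes> A) = g \<otimes> (g \<otimes> B \<otimes> A)" using car by (simp add: m_assoc)
    also have "\<dots> = g \<otimes> C" using car AA by (simp add: gB m_assoc)
    finally show ?thesis by (simp add: gC)
  qed
  have BC: "B \<otimes> C = g \<otimes> g \<otimes> (C \<otimes> B)"
  proof -
    have "g \<otimes> g \<otimes> (C \<otimes> B) = g \<otimes> (g \<otimes> C \<otimes> B)" using car by (simp add: m_assoc)
    also have "\<dots> = g \<otimes> A" using car BB by (simp add: gC m_assoc)
    finally show ?thesis by (simp add: gA)
  qed
  have CA: "C \<otimes> A = g \<otimes> g \<otimes> (A \<otimes> C)"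
  proof -
    have "g \<otimes> g \<otimes> (A \<otimes> C) = g \<otimes> (g \<otimes> A \<otimes> C)" using car by (simp add: m_assoc)
    also have "\<dots> = g \<otimes> B" using car CC by (simp add: gA m_assoc)
    finally show ?thesis by (simp add: gB)
  qed
  have ggA: "A \<otimes> (g \<otimes> g) = g \<otimes> g \<otimes> A"
    using car Ag gA by (metis m_assoc)
  \<comment> \<open>Conjugation by \<open>A\<close> turns \<open>A B = g g B A\<close> into
    \<open>B A = g g A B\<close>. Both rules together give \<open>B A = g g g g B A\<close>, where
    \<open>B A\<close> is invertible.\<close>
  have "B \<otimes> A = A \<otimes> (A \<otimes> B) \<otimes> A" using cancel car by simp
  also have "\<dots> = A \<otimes> (g \<otimes> g \<otimes> (B \<otimes> A)) \<otimes> A" by (simp add: AB)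
  also have "\<dots> = A \<otimes> (g \<otimes> g) \<otimes> B \<otimes> (A \<otimes> A)" using car by (simp add: m_assoc)
  also have "\<dots> = g \<otimes> g \<otimes> (A \<otimes> B)" using car by (simp add: ggA AA m_assoc)
  also have "\<dots> = g \<otimes> g \<otimes> (g \<otimes> g) \<otimes> (B \<otimes> A)" using car by (subst AB) (simp add: m_assoc)
  finally have "B \<otimes> A \<otimes> (A \<otimes> B) = g \<otimes> g \<otimes> (g \<otimes> g) \<otimes> (B \<otimes> A) \<otimes> (A \<otimes> B)" by simp
  moreover have "B \<otimes> A \<otimes> (A \<otimes> B) = \<one>" using car cancel BB by (simp add: m_assoc)
  ultimately have "g \<otimes> g \<otimes> (g \<otimes> g) = \<one>" using car by (metis m_assoc m_closed r_one)
  moreover have "X \<otimes> g = g \<otimes> X" if "X \<in> {A, B, C}" for X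
    using that Ag gA Bg gB Cg gC by auto
  ultimately show thesis using that[OF g _ AB BC CA] by blast
qed

text \<open>Modulo multiples of \<open>k\<close> the letters commute and have square zero. Among
  four letters taken from three, one occurs twice, and its occurrences can be moved next to each
  other.\<close>

lemma quad_prod_multiple:
  assumes k: "k \<in> carrier R" and S: "S \<subseteq> carrier R"
    and central: "\<And>x. x \<in> S \<Longrightarrow> x \<otimes> k = k \<otimes> x"
    and sq: "\<And>x. x \<in> S \<Longrightarrow> x \<otimes> x = \<zero>"
    and swap: "\<And>x y. x \<in> S \<Longrightarrow> y \<in> S \<Longrightarrow> \<exists>r\<in>carrier R. x \<otimes> y = y \<otimes> x \<oplus> k \<otimes> r"
    and card: "S = {a, b, c}"
    and x: "x1 \<in> S" "x2 \<in> S" "x3 \<in> S" "x4 \<in> S"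
  shows "\<exists>r\<in>carrier R. x1 \<otimes> (x2 \<otimes> (x3 \<otimes> x4)) = k \<otimes> r"
proof -
  let ?M = "{k \<otimes> r |r. r \<in> carrier R}"
  \<comment> \<open>\<open>?M\<close> is a right ideal; since \<open>k\<close> commutes with the
    letters, it is also stable under left multiplication by letters.\<close>
  have left: "x \<otimes> m \<in> ?M" if x: "x \<in> S" and "m \<in> ?M" for x m
  proof -
    from that obtain r where r: "r \<in> carrier R" "m = k \<otimes> r" by blast
    then have "x \<otimes> m = k \<otimes> (x \<otimes> r)" using x S k central[OF x]
      by (metis m_assoc subsetD)
    then show ?thesis using r x S by blast
  qed
  have right: "m \<otimes> y \<in> ?M" if "m \<in> ?M" "y \<in> carrier R" for m y
    using that k by (auto simp: m_assoc)
  have add: "m \<oplus> m' \<in> ?M" if "m \<in> ?M" "m' \<in> ?M" for m m'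
  proof -
    from that obtain r r' where "r \<in> carrier R" "m = k \<otimes> r" "r' \<in> carrier R" "m' = k \<otimes> r'" by blast
    then have "m \<oplus> m' = k \<otimes> (r \<oplus> r')" "r \<oplus> r' \<in> carrier R" using k by (simp_all add: r_distr)
    then show ?thesis by blast
  qed
  have zero: "\<zero> \<in> ?M" using k by (auto intro!: exI[of _ \<zero>])
  have SC: "x \<in> carrier R" if "x \<in> S" for x using that S by blast
  have swp: "x \<otimes> (y \<otimes> z) \<in> ?M" if "x \<in> S" "y \<in> S" "z \<in> carrier R" "y \<otimes> (x \<otimes> z) \<in> ?M" for x y z
  proof -
    from swap[OF that(1,2)] obtain r where r: "r \<in> carrier R" "x \<otimes> y = y \<otimes> x \<oplus> k \<otimes> r" by blast
    have "x \<otimes> (y \<otimes> z) = (y \<otimes> x \<oplus> k \<otimes> r) \<otimes> z"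
      using that SC r by (simp add: m_assoc[symmetric])
    also have "\<dots> = y \<otimes> (x \<otimes> z) \<oplus> k \<otimes> (r \<otimes> z)"
      using that SC r k by (simp add: l_distr m_assoc)
    finally show ?thesis using add[OF that(4), of "k \<otimes> (r \<otimes> z)"] r(1) that(3) by auto
  qed
  have sq0: "x \<otimes> (x \<otimes> z) \<in> ?M" if "x \<in> S" "z \<in> carrier R" for x z
    using that SC sq[OF that(1)] zero by (simp add: m_assoc[symmetric])
  have sq1: "x \<otimes> x \<in> ?M" if "x \<in> S" for x
    using zero sq[OF that] by simp
  \<comment> \<open>Equal letters at distance two, with and without a further factor, and then at
    distance three.\<close>
  have three: "x \<otimes> (y \<otimes> (x \<otimes> z)) \<in> ?M" if "x \<in> S" "y \<in> S" "z \<in> carrier R" for x y z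
    using swp[OF that(1,2)] left[OF that(2) sq0[OF that(1,3)]] that SC by simp
  have three': "y \<otimes> (x \<otimes> y) \<in> ?M" if "x \<in> S" "y \<in> S" for x y
    using swp[OF that(2,1) SC[OF that(2)]] left[OF that(1) sq1[OF that(2)]] by simp
  have four: "x \<otimes> (y \<otimes> (z \<otimes> x)) \<in> ?M" if "x \<in> S" "y \<in> S" "z \<in> S" for x y z
    using swp[OF that(1,2), of "z \<otimes> x"] left[OF that(2) three'[OF that(3,1)]] that SC by simp
  have "x1 = x2 \<or> x1 = x3 \<or> x1 = x4 \<or> x2 = x3 \<or> x2 = x4 \<or> x3 = x4"
    using x unfolding card by auto
  then have "x1 \<otimes> (x2 \<otimes> (x3 \<otimes> x4)) \<in> ?M"
    using x SC sq0 three four left sq1 three' by (elim disjE) simp_all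
  then show ?thesis by blast
qed

text \<open>Both halves of the word are multiples of \<open>k\<close>. Moving the second
  \<open>k\<close> across the letters of the first half produces the factor
  \<open>k k\<close>.\<close>

lemma eight_prod_zero:
  assumes k: "k \<in> carrier R" and S: "S \<subseteq> carrier R" and kk: "k \<otimes> k = \<zero>"
    and central: "\<And>x. x \<in> S \<Longrightarrow> x \<otimes> k = k \<otimes> x"
    and four: "\<And>x1 x2 x3 x4. x1 \<in> S \<Longrightarrow> x2 \<in> S \<Longrightarrow> x3 \<in> S \<Longrightarrow> x4 \<in> S \<Longrightarrow>
       \<exists>r\<in>carrier R. x1 \<otimes> (x2 \<otimes> (x3 \<otimes> x4)) = k \<otimes> r"
    and x: "x1 \<in> S" "x2 \<in> S" "x3 \<in> S" "x4 \<in> S" "y1 \<in> S" "y2 \<in> S" "y3 \<in> S" "y4 \<in> S"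
  shows "x1 \<otimes> (x2 \<otimes> (x3 \<otimes> (x4 \<otimes> (y1 \<otimes> (y2 \<otimes> (y3 \<otimes> y4)))))) = \<zero>"
proof -
  obtain r where r: "r \<in> carrier R" "y1 \<otimes> (y2 \<otimes> (y3 \<otimes> y4)) = k \<otimes> r"
    using four x by blast
  obtain s where s: "s \<in> carrier R" "x1 \<otimes> (x2 \<otimes> (x3 \<otimes> x4)) = k \<otimes> s"
    using four x by blast
  have SC: "x \<in> carrier R" if "x \<in> S" for x using that S by blast
  have ck: "x \<otimes> (k \<otimes> z) = k \<otimes> (x \<otimes> z)" if "x \<in> S" "z \<in> carrier R" for x z
    using that SC[OF that(1)] central[OF that(1)] k by (metis m_assoc)
  have "x1 \<otimes> (x2 \<otimes> (x3 \<otimes> (x4 \<otimes> (k \<otimes> r)))) = k \<otimes> (x1 \<otimes> (x2 \<otimes> (x3 \<otimes> x4)) \<otimes> r)"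
    using x SC ck r(1) k by (simp add: m_assoc)
  also have "\<dots> = k \<otimes> k \<otimes> (s \<otimes> r)" using s r k by (simp add: m_assoc)
  finally show ?thesis using s r k by (simp add: kk)
qed

text \<open>Adding 1 to each letter gives three involutions: the squares are 1 because 2 = 0, and
  \<open>(1 + b)(1 + c)\<close> is 1 plus the element that commutes with \<open>a\<close>.\<close>

lemma char2_eight_prod_zero:
  assumes car: "a \<in> carrier R" "b \<in> carrier R" "c \<in> carrier R"
    and two: "\<one> \<oplus> \<one> = \<zero>"
    and sq: "a \<otimes> a = \<zero>" "b \<otimes> b = \<zero>" "c \<otimes> c = \<zero>"
    and comm: "a \<otimes> (b \<oplus> c \<oplus> b \<otimes> c) = (b \<oplus> c \<oplus> b \<otimes> c) \<otimes> a"
      "b \<otimes> (c \<oplus> a \<oplus> c \<otimes> a) = (c \<oplus> a \<oplus> c \<otimes> a) \<otimes> b"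
    and x: "x1 \<in> {a, b, c}" "x2 \<in> {a, b, c}" "x3 \<in> {a, b, c}" "x4 \<in> {a, b, c}"
      "y1 \<in> {a, b, c}" "y2 \<in> {a, b, c}" "y3 \<in> {a, b, c}" "y4 \<in> {a, b, c}"
  shows "x1 \<otimes> (x2 \<otimes> (x3 \<otimes> (x4 \<otimes> (y1 \<otimes> (y2 \<otimes> (y3 \<otimes> y4)))))) = \<zero>"
proof -
  let ?u = "\<lambda>x. \<one> \<oplus> x"
  note c2 = char2_add[OF two]
  have c2': "x \<oplus> (x \<oplus> y) = y" if "x \<in> carrier R" "y \<in> carrier R" for x y
    using that c2 by (simp add: a_assoc[symmetric])
  have inv: "?u x \<otimes> ?u x = \<one>" if "x \<in> carrier R" "x \<otimes> x = \<zero>" for x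
    using that c2' by (simp add: l_distr r_distr a_ac c2)
  have comm1: "?u x \<otimes> (?u y \<otimes> ?u z) = ?u y \<otimes> ?u z \<otimes> ?u x"
    if "x \<in> carrier R" "y \<in> carrier R" "z \<in> carrier R"
      "x \<otimes> (y \<oplus> z \<oplus> y \<otimes> z) = (y \<oplus> z \<oplus> y \<otimes> z) \<otimes> x" for x y z
  proof -
    let ?w = "y \<oplus> z \<oplus> y \<otimes> z"
    have "?u y \<otimes> ?u z = ?u ?w" using that by (simp add: l_distr r_distr a_ac)
    moreover have "?u x \<otimes> ?u w = ?u w \<otimes> ?u x" if "w \<in> carrier R" "x \<otimes> w = w \<otimes> x" for w
      using that \<open>x \<in> carrier R\<close> by (simp add: l_distr r_distr a_ac)
    ultimately show ?thesis using that by simp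
  qed
  obtain g where g: "g \<in> carrier R" "\<And>X. X \<in> {?u a, ?u b, ?u c} \<Longrightarrow> X \<otimes> g = g \<otimes> X"
    and sw: "?u a \<otimes> ?u b = g \<otimes> g \<otimes> (?u b \<otimes> ?u a)"
    "?u b \<otimes> ?u c = g \<otimes> g \<otimes> (?u c \<otimes> ?u b)"
    "?u c \<otimes> ?u a = g \<otimes> g \<otimes> (?u a \<otimes> ?u c)"
    and g4: "g \<otimes> g \<otimes> (g \<otimes> g) = \<one>"
    by (rule three_involutions_commutators[of "?u a" "?u b" "?u c"])
      (use car sq comm inv comm1 in auto)
  \<comment> \<open>As 2 = 0, also \<open>g g = 1 + k\<close>. Then \<open>g g g g = 1\<close>
    becomes \<open>k k = 0\<close>, and an exchange of letters costs a multiple of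
    \<open>k\<close>.\<close>
  define k where "k = \<one> \<oplus> g \<otimes> g"
  have k: "k \<in> carrier R" using g by (simp add: k_def)
  have gg: "g \<otimes> g = \<one> \<oplus> k" using g c2' by (simp add: k_def)
  have "(\<one> \<oplus> k) \<otimes> (\<one> \<oplus> k) = \<one> \<oplus> k \<otimes> k"
    using k c2' by (simp add: l_distr r_distr a_ac)
  then have kk: "k \<otimes> k = \<zero>" using g4 k unfolding gg by simp
  let ?S = "{a, b, c}"
  have gx: "x \<otimes> g = g \<otimes> x" if "x \<in> ?S" for x
  proof -
    have "x \<in> carrier R" "?u x \<otimes> g = g \<otimes> ?u x" using that g(2) car by auto
    then show ?thesis using g(1) by (simp add: l_distr r_distr)
  qed
  have central: "x \<otimes> k = k \<otimes> x" if "x \<in> ?S" for x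
  proof -
    have "x \<in> carrier R" using that car by auto
    then have "x \<otimes> (g \<otimes> g) = g \<otimes> g \<otimes> x" using gx[OF that] g(1) by (metis m_assoc)
    then show ?thesis using \<open>x \<in> carrier R\<close> g(1) by (simp add: k_def l_distr r_distr)
  qed
  \<comment> \<open>Expanding \<open>(1 + x)(1 + y) = (1 + k)(1 + y)(1 + x)\<close>, the terms
    \<open>1 + x + y\<close> occur on both sides and cancel.\<close>
  have swap1: "x \<otimes> y = y \<otimes> x \<oplus> k \<otimes> (?u y \<otimes> ?u x)"
    if "x \<in> carrier R" "y \<in> carrier R" and eq: "?u x \<otimes> ?u y = g \<otimes> g \<otimes> (?u y \<otimes> ?u x)" for x y
  proof -
    let ?r = "k \<otimes> (?u y \<otimes> ?u x)"
    have r: "?r \<in> carrier R" using that k by simp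
    have "?u x \<otimes> ?u y = ?u y \<otimes> ?u x \<oplus> ?r" using that k by (subst eq) (simp add: gg l_distr)
    moreover have "?u x \<otimes> ?u y = \<one> \<oplus> (x \<oplus> (y \<oplus> x \<otimes> y))"
      using that by (simp add: l_distr r_distr a_ac)
    moreover have "?u y \<otimes> ?u x \<oplus> ?r = \<one> \<oplus> (x \<oplus> (y \<oplus> (y \<otimes> x \<oplus> ?r)))"
    proof -
      have "?u y \<otimes> ?u x = \<one> \<oplus> (x \<oplus> (y \<oplus> y \<otimes> x))" using that by (simp add: l_distr r_distr a_ac)
      then show ?thesis using that r by (simp add: a_assoc)
    qed
    ultimately have "\<one> \<oplus> (x \<oplus> (y \<oplus> x \<otimes> y)) = \<one> \<oplus> (x \<oplus> (y \<oplus> (y \<otimes> x \<oplus> ?r)))" by simp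
    then show ?thesis using that r by simp
  qed
  \<comment> \<open>The correction added twice is 0, so the same correction serves in the opposite
    direction.\<close>
  have swap2: "y \<otimes> x = x \<otimes> y \<oplus> k \<otimes> (?u y \<otimes> ?u x)"
    if "x \<in> carrier R" "y \<in> carrier R" and "x \<otimes> y = y \<otimes> x \<oplus> k \<otimes> (?u y \<otimes> ?u x)" for x y
    using that k c2 by (simp add: a_assoc)
  have uc: "?u x \<otimes> ?u y \<in> carrier R" if "x \<in> carrier R" "y \<in> carrier R" for x y
    using that by simp
  note fwd = swap1[OF car(1,2) sw(1)] swap1[OF car(2,3) sw(2)] swap1[OF car(3,1) sw(3)]
  note bwd = swap2[OF car(1,2) fwd(1)] swap2[OF car(2,3) fwd(2)] swap2[OF car(3,1) fwd(3)]
  define P where "P x y \<longleftrightarrow> (\<exists>r\<in>carrier R. x \<otimes> y = y \<otimes> x \<oplus> k \<otimes> r)" for x y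
  have diag: "P x x" if "x \<in> carrier R" for x
    unfolding P_def using that k by (intro bexI[of _ \<zero>]) simp_all
  have "P a b" unfolding P_def using fwd(1) uc[OF car(2,1)] by (rule bexI)
  moreover have "P b c" unfolding P_def using fwd(2) uc[OF car(3,2)] by (rule bexI)
  moreover have "P c a" unfolding P_def using fwd(3) uc[OF car(1,3)] by (rule bexI)
  moreover have "P b a" unfolding P_def using bwd(1) uc[OF car(2,1)] by (rule bexI)
  moreover have "P c b" unfolding P_def using bwd(2) uc[OF car(3,2)] by (rule bexI)
  moreover have "P a c" unfolding P_def using bwd(3) uc[OF car(1,3)] by (rule bexI)
  ultimately have swap: "\<exists>r\<in>carrier R. x \<otimes> y = y \<otimes> x \<oplus> k \<otimes> r" if "x \<in> ?S" "y \<in> ?S" for x y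
    using that diag car unfolding P_def[symmetric] by blast
  have S: "?S \<subseteq> carrier R" using car by auto
  have sqS: "x \<otimes> x = \<zero>" if "x \<in> ?S" for x using that sq by auto
  have four: "\<exists>r\<in>carrier R. x1 \<otimes> (x2 \<otimes> (x3 \<otimes> x4)) = k \<otimes> r"
    if "x1 \<in> ?S" "x2 \<in> ?S" "x3 \<in> ?S" "x4 \<in> ?S" for x1 x2 x3 x4
    using k S central sqS swap refl that by (rule quad_prod_multiple)
  show ?thesis
    using k S kk central four x by (rule eight_prod_zero)
qed

end

text \<open>Only the additive group of values is used, and commutation is required only inside words
  of five letters: in the application the cubic terms vanish only in such a context. All words
  \<open>v x y x y\<close> with \<open>x\<close> and \<open>y\<close> distinct get the same value,
  which is 0 because one of them begins with a square.\<close>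

lemma (in abelian_group) five_words_zero:
  fixes f :: "nat list \<Rightarrow> 'a"
  assumes car: "\<And>w. f w \<in> carrier G"
    and tors: "\<And>x. x \<in> carrier G \<Longrightarrow> x \<oplus> x = \<zero> \<Longrightarrow> x = \<zero>"
    and sq: "\<And>p x q. f (p @ [x, x] @ q) = \<zero>"
    and comm: "\<And>p q x y z. length p + length q = 3 \<Longrightarrow> {x, y, z} = {1, 2, 3} \<Longrightarrow>
      f (p @ [x, y] @ q) \<oplus> f (p @ [x, z] @ q) = f (p @ [y, x] @ q) \<oplus> f (p @ [z, x] @ q)"
    and w: "length w = 5" "set w \<subseteq> {1, 2, 3}"
  shows "f w = \<zero>"
proof -
  have sqs: "f [x, x, y, z, t] = \<zero>" "f [y, x, x, z, t] = \<zero>" "f [y, z, x, x, t] = \<zero>"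
    "f [y, z, t, x, x] = \<zero>" for x y z t
    using sq[of "[]" x "[y, z, t]"] sq[of "[y]" x "[z, t]"] sq[of "[y, z]" x "[t]"]
      sq[of "[y, z, t]" x "[]"] by simp_all
  have r4: "f [v, p, q, x, y] \<oplus> f [v, p, q, x, z] = f [v, p, q, y, x] \<oplus> f [v, p, q, z, x]"
   and r3: "f [v, p, x, y, q] \<oplus> f [v, p, x, z, q] = f [v, p, y, x, q] \<oplus> f [v, p, z, x, q]"
   and r2: "f [v, x, y, p, q] \<oplus> f [v, x, z, p, q] = f [v, y, x, p, q] \<oplus> f [v, z, x, p, q]"
    if "{x, y, z} = {1, 2, 3}" for v p q x y z
    using comm[OF _ that, of "[v, p, q]" "[]"] comm[OF _ that, of "[v, p]" "[q]"]
      comm[OF _ that, of "[v]" "[p, q]"] by simp_all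
  have perm: "{x, z, y} = {1, 2, 3}" "{y, x, z} = {1, 2, 3}" "{y, z, x} = {1, 2, 3}"
     "{z, x, y} = {1, 2, 3}" "{z, y, x} = {1, 2, 3}" if "{x, y, z} = {1, 2, 3}" for x y z :: nat
    using that by blast+
  have neg: "s = \<ominus> t" if "s \<oplus> t = \<zero>" "s \<in> carrier G" "t \<in> carrier G" for s t
    using that by (metis minus_equality)
  \<comment> \<open>All three come from exchanging the third and the fourth letter; the other two
    words in the relation contain a square.\<close>
  have T2: "f [v, x, z, x, y] = \<ominus> f [v, x, y, x, y]" and T4: "f [v, x, y, z, y] = \<ominus> f [v, x, y, x, y]"
    and T3sym: "f [v, x, y, z, x] = f [v, x, z, y, x]"
    if P: "{x, y, z} = {1, 2, 3}" for v x y z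
  proof -
    have "f [v, x, y, x, y] \<oplus> f [v, x, z, x, y] = \<zero>"
      using r3[OF P, of v x y] car by (simp add: sqs)
    then show "f [v, x, z, x, y] = \<ominus> f [v, x, y, x, y]" using neg car by (metis a_comm)
    have "f [v, x, y, x, y] \<oplus> f [v, x, y, z, y] = \<zero>"
      using r3[OF perm(2)[OF P], of v x y] car by (simp add: sqs)
    then show "f [v, x, y, z, y] = \<ominus> f [v, x, y, x, y]" using neg car by (metis a_comm)
    show "f [v, x, y, z, x] = f [v, x, z, y, x]"
      using r3[OF perm(2)[OF P], of v x x] car by (simp add: sqs)
  qed
  have T3: "f [v, x, y, z, x] = f [v, x, y, x, y] \<oplus> \<ominus> f [v, x, z, x, z]"
    if P: "{x, y, z} = {1, 2, 3}" for v x y z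
    using r4[OF P, of v x y] T2[OF perm(1)[OF P], of v] car by (simp add: sqs)
  \<comment> \<open>By \<open>T3\<close> the value is antisymmetric in \<open>y\<close> and
    \<open>z\<close>, by \<open>T3sym\<close> it is symmetric. Hence its double vanishes, and the
    absence of 2-torsion applies.\<close>
  have T30: "f [v, x, y, z, x] = \<zero>" if P: "{x, y, z} = {1, 2, 3}" for v x y z
  proof (rule tors[OF car])
    have "f [v, x, y, z, x] \<oplus> f [v, x, z, y, x] = \<zero>"
      unfolding T3[OF P] T3[OF perm(1)[OF P]] using car
      by (simp add: a_ac r_neg r_neg1 r_neg2)
    then show "f [v, x, y, z, x] \<oplus> f [v, x, y, z, x] = \<zero>" using T3sym[OF P] by simp
  qed
  have T1a: "f [v, x, y, x, y] = f [v, x, z, x, z]" if P: "{x, y, z} = {1, 2, 3}" for v x y z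
    using T3[OF P, of v] T30[OF P, of v] car by (metis minus_minus neg a_inv_closed)
  have T1b: "f [v, y, x, y, x] = f [v, z, x, z, x]" if P: "{x, y, z} = {1, 2, 3}" for v x y z
  proof -
    have "f [v, z, x, y, x] = \<ominus> f [v, z, x, z, x]" using T4[OF perm(4)[OF P], of v] .
    then have "f [v, y, x, y, x] \<oplus> \<ominus> f [v, z, x, z, x] = \<zero>"
      using r2[OF P, of v y x] T30[OF perm(1)[OF P], of v] car by (simp add: sqs)
    then show ?thesis using car by (metis minus_minus neg a_inv_closed)
  qed
  \<comment> \<open>\<open>T1a\<close> changes the second letter of the alternating pattern and
    \<open>T1b\<close> the first, so all six patterns agree. In one that starts with
    \<open>v\<close> the word begins with \<open>v v\<close>.\<close>
  have T1: "f [v, x, y, x, y] = \<zero>" if P: "{x, y, z} = {1, 2, 3}" and v: "v \<in> {1, 2, 3}" for v x y z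
  proof -
    note T1a[OF P, of v] T1a[OF perm(2)[OF P], of v] T1a[OF perm(5)[OF P], of v]
      T1b[OF P, of v] T1b[OF perm(2)[OF P], of v] T1b[OF perm(5)[OF P], of v]
    moreover have "v = x \<or> v = y \<or> v = z" using P v by blast
    ultimately show ?thesis using sqs(1)[of v] by metis
  qed
  obtain v x y s t where w5: "w = [v, x, y, s, t]"
    using w(1) by (auto simp: numeral_eq_Suc length_Suc_conv)
  show ?thesis
  proof (cases "x = y \<or> y = s \<or> s = t")
    case True
    then show ?thesis using sqs w5 by auto
  next
    case False
    have xy: "x \<in> {1, 2, 3}" "y \<in> {1, 2, 3}" "x \<noteq> y" using w(2) False unfolding w5 by simp_all
    obtain z where z: "{x, y, z} = {1, 2, 3}"
    proof
      \<comment> \<open>The three indices add up to 6, so the last element is the missing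
        one.\<close>
      show "{x, y, 6 - x - y} = {1, 2, 3}" using xy by (elim insertE emptyE) auto
    qed
    have v: "v \<in> {1, 2, 3}" and "s \<in> {x, y, z}" "t \<in> {x, y, z}"
      using w(2) unfolding w5 z by auto
    then consider "s = x" "t = y" | "s = x" "t = z" | "s = z" "t = x" | "s = z" "t = y"
      using False by blast
    then show ?thesis
      unfolding w5
    proof cases
      case 1
      then show "f [v, x, y, s, t] = \<zero>" using T1[OF z v] by simp
    next
      case 2
      then show "f [v, x, y, s, t] = \<zero>"
        using T2[OF perm(1)[OF z], of v] T1[OF perm(1)[OF z] v] by simp
    next
      case 3
      then show "f [v, x, y, s, t] = \<zero>" using T30[OF z, of v] by simp
    next
      case 4
      then show "f [v, x, y, s, t] = \<zero>" using T4[OF z, of v] T1[OF z v] by simp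
    qed
  qed
qed

section \<open>Relations between the cycles of \<open>X\<^sub>7\<close>\<close>

definition Delta_word :: "nat \<Rightarrow> X7_arrow list" where
  "Delta_word i = [Alpha i, Delta i, Gamma i]"

text \<open>Up to rotation of its cycles the potential is invariant under the cyclic shift of 1, 2,
  3, while a transposition changes the cubic term. The relations at \<open>i\<close> are therefore
  indexed by an oriented triple.\<close>

definition cyclic_triples :: "(nat \<times> nat \<times> nat) set" where
  "cyclic_triples = {(1, 2, 3), (2, 3, 1), (3, 1, 2)}"

text \<open>A family containing both potentials, so that outside characteristic 2 one argument
  covers them.\<close>

definition X7_W :: "'k::field \<Rightarrow> 'k X7_series" where
  "X7_W t = (\<lambda>s. X7_W0 s + t * path_monomial 0 (Delta_word 1 @ Delta_word 2 @ Delta_word 3) s)"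

lemma X7_W0_eq:
  "X7_W0 = (\<lambda>s. path_monomial 0 [Alpha 1, Beta 1, Gamma 1] s + path_monomial 0 [Alpha 2, Beta 2, Gamma 2] s
    + path_monomial 0 [Alpha 3, Beta 3, Gamma 3] s + path_monomial 0 (Delta_word 1 @ Delta_word 2) s
    + path_monomial 0 (Delta_word 2 @ Delta_word 3) s + path_monomial 0 (Delta_word 3 @ Delta_word 1) s)"
  unfolding X7_W0_def X7_B_eq X7_Delta_eq Let_def complete_path_algebra_def path_monomial_def Delta_word_def
  by (simp add: path_series_mult_single X7_def pre_digraph.awalk_verts_conv)

lemma X7_W0_conv: "X7_W0 = X7_W 0"
  by (simp add: X7_W_def)

lemma X7_W1_conv: "X7_W1 = X7_W 1"
  unfolding X7_W1_def X7_W_def X7_Delta_eq Let_def complete_path_algebra_def path_monomial_def Delta_word_def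
  by (simp add: path_series_mult_single X7_def pre_digraph.awalk_verts_conv)

lemma X7_awalk:
  "pre_digraph.awalk X7 u p v \<longleftrightarrow> u \<in> {0..6} \<and> set p \<subseteq> arcs X7 \<and> pre_digraph.cas X7 u p v"
  by (simp add: pre_digraph.awalk_def X7_def)

lemma X7_cas_simps [simp]:
  "pre_digraph.cas X7 u [] v \<longleftrightarrow> u = v"
  "pre_digraph.cas X7 u (a # p) v \<longleftrightarrow> X7_tail a = u \<and> pre_digraph.cas X7 (X7_head a) p v"
  by (simp_all add: pre_digraph.cas.simps X7_def)

lemma X7_arcs [simp]:
  "Alpha i \<in> arcs X7 \<longleftrightarrow> i \<in> {1, 2, 3}" "Beta i \<in> arcs X7 \<longleftrightarrow> i \<in> {1, 2, 3}"
  "Gamma i \<in> arcs X7 \<longleftrightarrow> i \<in> {1, 2, 3}" "Delta i \<in> arcs X7 \<longleftrightarrow> i \<in> {1, 2, 3}"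
  by (auto simp: X7_def)

lemma X7_head_simp [simp]: "head X7 = X7_head" and X7_tail_simp [simp]: "tail X7 = X7_tail"
  by (simp_all add: X7_def)

text \<open>The derivatives at \<open>Beta i\<close> are the source of the zero squares. Those at
  \<open>Alpha i\<close> and \<open>Gamma i\<close> express the cycle through \<open>Beta i\<close>
  by longer paths in two ways, which yields the commutation relations.\<close>

lemma X7_cyclic_derivatives:
  assumes "(i, j, k) \<in> cyclic_triples"
  shows "cyclic_derivative X7 (Alpha i) (X7_W (t::'a::field)) =
      (\<lambda>s. path_monomial (2 * i - 1) [Beta i, Gamma i] s
        + path_monomial (2 * i - 1) ([Delta i, Gamma i] @ Delta_word j) s
        + path_monomial (2 * i - 1) ([Delta i, Gamma i] @ Delta_word k) s
        + t * path_monomial (2 * i - 1) ([Delta i, Gamma i] @ Delta_word j @ Delta_word k) s)" (is ?A)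
    and "cyclic_derivative X7 (Gamma i) (X7_W t) =
      (\<lambda>s. path_monomial 0 [Alpha i, Beta i] s
        + path_monomial 0 (Delta_word j @ [Alpha i, Delta i]) s
        + path_monomial 0 (Delta_word k @ [Alpha i, Delta i]) s
        + t * path_monomial 0 (Delta_word j @ Delta_word k @ [Alpha i, Delta i]) s)" (is ?C)
    and "cyclic_derivative X7 (Beta i) (X7_W t) = path_monomial (2 * i) [Gamma i, Alpha i]" (is ?B)
    and "cyclic_derivative X7 (Delta i) (X7_W t) =
      (\<lambda>s. path_monomial (2 * i) ([Gamma i] @ Delta_word j @ [Alpha i]) s
        + path_monomial (2 * i) ([Gamma i] @ Delta_word k @ [Alpha i]) s
        + t * path_monomial (2 * i) ([Gamma i] @ Delta_word j @ Delta_word k @ [Alpha i]) s)" (is ?D)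
proof -
  have cyc: "(0, [Alpha i, Beta i, Gamma i]) \<in> quiver_cycles X7"
     "(0, Delta_word i @ Delta_word j) \<in> quiver_cycles X7"
     "(0, Delta_word i @ Delta_word j @ Delta_word k) \<in> quiver_cycles X7"
    if "i \<in> {1, 2, 3}" "j \<in> {1, 2, 3}" "k \<in> {1, 2, 3}" for i j k
    using that by (auto simp: quiver_cycles_def X7_awalk Delta_word_def)
  note der = cyc[THEN cyclic_derivative_path_monomial[OF fin_digraph_X7]]
  have dB: "cyclic_derivative X7 a (path_monomial 0 [Alpha i, Beta i, Gamma i]) = (\<lambda>s.
      (if a = Alpha i then path_monomial (2 * i - 1) [Beta i, Gamma i] s else (0::'a))
      + (if a = Beta i then path_monomial (2 * i) [Gamma i, Alpha i] s else 0)
      + (if a = Gamma i then path_monomial 0 [Alpha i, Beta i] s else 0))"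
    if "i \<in> {1, 2, 3}" for a i
    unfolding der(1)[OF that that that]
    by (simp add: sum.lessThan_Suc_shift fun_eq_iff eq_commute[of _ a] del: One_nat_def)
  have dDD: "cyclic_derivative X7 a (path_monomial 0 (Delta_word i @ Delta_word j)) = (\<lambda>s.
      (if a = Alpha i then path_monomial (2 * i - 1) ([Delta i, Gamma i] @ Delta_word j) s else (0::'a))
      + (if a = Delta i then path_monomial (2 * i) ([Gamma i] @ Delta_word j @ [Alpha i]) s else 0)
      + (if a = Gamma i then path_monomial 0 (Delta_word j @ [Alpha i, Delta i]) s else 0)
      + (if a = Alpha j then path_monomial (2 * j - 1) ([Delta j, Gamma j] @ Delta_word i) s else 0)
      + (if a = Delta j then path_monomial (2 * j) ([Gamma j] @ Delta_word i @ [Alpha j]) s else 0)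
      + (if a = Gamma j then path_monomial 0 (Delta_word i @ [Alpha j, Delta j]) s else 0))"
    if "i \<in> {1, 2, 3}" "j \<in> {1, 2, 3}" for a i j
    unfolding der(2)[OF that that(1)]
    by (simp add: sum.lessThan_Suc_shift Delta_word_def fun_eq_iff eq_commute[of _ a] del: One_nat_def)
  have dDDD: "cyclic_derivative X7 a (path_monomial 0 (Delta_word i @ Delta_word j @ Delta_word k)) = (\<lambda>s.
      (if a = Alpha i then path_monomial (2 * i - 1) ([Delta i, Gamma i] @ Delta_word j @ Delta_word k) s else (0::'a))
      + (if a = Delta i then path_monomial (2 * i) ([Gamma i] @ Delta_word j @ Delta_word k @ [Alpha i]) s else 0)
      + (if a = Gamma i then path_monomial 0 (Delta_word j @ Delta_word k @ [Alpha i, Delta i]) s else 0)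
      + (if a = Alpha j then path_monomial (2 * j - 1) ([Delta j, Gamma j] @ Delta_word k @ Delta_word i) s else 0)
      + (if a = Delta j then path_monomial (2 * j) ([Gamma j] @ Delta_word k @ Delta_word i @ [Alpha j]) s else 0)
      + (if a = Gamma j then path_monomial 0 (Delta_word k @ Delta_word i @ [Alpha j, Delta j]) s else 0)
      + (if a = Alpha k then path_monomial (2 * k - 1) ([Delta k, Gamma k] @ Delta_word i @ Delta_word j) s else 0)
      + (if a = Delta k then path_monomial (2 * k) ([Gamma k] @ Delta_word i @ Delta_word j @ [Alpha k]) s else 0)
      + (if a = Gamma k then path_monomial 0 (Delta_word i @ Delta_word j @ [Alpha k, Delta k]) s else 0))"
    if "i \<in> {1, 2, 3}" "j \<in> {1, 2, 3}" "k \<in> {1, 2, 3}" for a i j k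
    unfolding der(3)[OF that]
    by (simp add: sum.lessThan_Suc_shift Delta_word_def fun_eq_iff eq_commute[of _ a] del: One_nat_def)
  have exp: "cyclic_derivative X7 a (X7_W t) = (\<lambda>s.
      cyclic_derivative X7 a (path_monomial 0 [Alpha 1, Beta 1, Gamma 1]) s
      + cyclic_derivative X7 a (path_monomial 0 [Alpha 2, Beta 2, Gamma 2]) s
      + cyclic_derivative X7 a (path_monomial 0 [Alpha 3, Beta 3, Gamma 3]) s
      + cyclic_derivative X7 a (path_monomial 0 (Delta_word 1 @ Delta_word 2)) s
      + cyclic_derivative X7 a (path_monomial 0 (Delta_word 2 @ Delta_word 3)) s
      + cyclic_derivative X7 a (path_monomial 0 (Delta_word 3 @ Delta_word 1)) s
      + t * cyclic_derivative X7 a (path_monomial 0 (Delta_word 1 @ Delta_word 2 @ Delta_word 3)) s)" for a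
    unfolding X7_W_def X7_W0_eq cyclic_derivative_add cyclic_derivative_smult ..
  show ?A ?C ?B ?D
    using assms unfolding cyclic_triples_def
    by (elim insertE emptyE Pair_inject; hypsubst; simp add: exp dB dDD dDDD add_ac)+
qed

section \<open>Words in the three cycles and their relations\<close>

lemma X7_awlast: "pre_digraph.awlast X7 u p = (if p = [] then u else X7_head (last p))"
  by (simp add: pre_digraph.awalk_verts_conv last_map)

lemma X7_monomial_mult:
  assumes "(if p = [] then u else X7_head (last p)) = v"
  shows "path_series_mult X7 (path_monomial u p) (path_monomial v q) = path_monomial u (p @ q)"
  using path_monomial_mult[of X7 u p v q] assms by (simp add: X7_awlast complete_path_algebra_simps)

lemmas X7_mult_simps = path_series_mult_add path_series_mult_smult X7_monomial_mult

lemma wf_digraph_X7: "wf_digraph X7"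
  by (rule fin_digraph.axioms(1)[OF fin_digraph_X7])

lemma X7_paths: "(u, p) \<in> quiver_paths X7 \<longleftrightarrow>
    (\<exists>v. u \<in> {0..6} \<and> set p \<subseteq> arcs X7 \<and> pre_digraph.cas X7 u p v)"
  by (simp add: quiver_paths_def X7_awalk)

definition Delta_monomial :: "nat list \<Rightarrow> 'k::field X7_series" where
  "Delta_monomial w = path_monomial 0 (concat (map Delta_word w))"

text \<open>The ideal before taking the closure. Relations are derived here, and adding
  \<open>order_ideal\<close> accounts for the closure.\<close>

definition Jacobian_relations :: "'k::field \<Rightarrow> 'k X7_series set" where
  "Jacobian_relations t = Idl\<^bsub>complete_path_algebra X7\<^esub> {cyclic_derivative X7 a (X7_W t) |a. a \<in> arcs X7}"

lemma concat_Delta_word_last: "X7_head (last (concat (map Delta_word w))) = 0" if "w \<noteq> []"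
  using that by (induction w) (auto simp: Delta_word_def)

lemma Delta_words_cas: "pre_digraph.cas X7 0 (concat (map Delta_word w)) 0"
  by (induction w) (auto simp: Delta_word_def)

lemma Delta_words_path: "(0, concat (map Delta_word w)) \<in> quiver_paths X7" if "set w \<subseteq> {1, 2, 3}"
proof -
  have "set (concat (map Delta_word w)) \<subseteq> arcs X7"
    using that by (auto simp: Delta_word_def)
  then show ?thesis using Delta_words_cas unfolding X7_paths by auto
qed

lemma Delta_words_length: "length (concat (map Delta_word w)) = 3 * length w"
  by (induction w) (auto simp: Delta_word_def)

lemma Delta_monomial_order: "Delta_monomial w \<in> order_ideal X7 (3 * length w)" if "set w \<subseteq> {1, 2, 3}"
  unfolding Delta_monomial_def
  by (intro path_monomial_order_ideal Delta_words_path that) (simp add: Delta_words_length)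

lemma Delta_monomial_carrier:
  "set w \<subseteq> {1, 2, 3} \<Longrightarrow> Delta_monomial w \<in> carrier (complete_path_algebra X7)"
  unfolding Delta_monomial_def by (rule path_monomial_carrier[OF Delta_words_path])

lemma Delta_monomial_mult:
  "path_series_mult X7 (Delta_monomial v) (Delta_monomial w) = Delta_monomial (v @ w)"
  unfolding Delta_monomial_def using concat_Delta_word_last[of v]
  by (cases v) (simp_all add: X7_monomial_mult Delta_word_def)

lemma ideal_Jacobian_relations: "ideal (Jacobian_relations t) (complete_path_algebra X7)"
  unfolding Jacobian_relations_def
  using cyclic_derivative_carrier[OF wf_digraph_X7]
  by (intro ring.genideal_ideal ring_complete_path_algebra wf_digraph_X7) auto

lemma cyclic_derivative_Jacobian_relations:
  "a \<in> arcs X7 \<Longrightarrow> cyclic_derivative X7 a (X7_W t) \<in> Jacobian_relations t"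
  unfolding Jacobian_relations_def
  using cyclic_derivative_carrier[OF wf_digraph_X7]
  by (intro subsetD[OF ring.genideal_self[OF ring_complete_path_algebra[OF wf_digraph_X7]]]) auto

lemma cyclic_triples_range: "(i, j, k) \<in> cyclic_triples \<Longrightarrow> i \<in> {1, 2, 3} \<and> j \<in> {1, 2, 3} \<and> k \<in> {1, 2, 3}"
  by (auto simp: cyclic_triples_def)

lemma cyclic_triples_ex: "i \<in> {1, 2, 3} \<Longrightarrow> \<exists>j k. (i, j, k) \<in> cyclic_triples"
  by (auto simp: cyclic_triples_def)

text \<open>The cycle through \<open>Delta i\<close> taken twice contains
  \<open>[Gamma i, Alpha i]\<close>, the derivative at \<open>Beta i\<close>.\<close>

lemma Delta_square_relation:
  assumes "i \<in> {1, 2, 3}"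
  shows "Delta_monomial [i, i] \<in> Jacobian_relations t"
proof -
  obtain j k where ijk: "(i, j, k) \<in> cyclic_triples" using cyclic_triples_ex[OF assms] by blast
  have c: "path_monomial 0 [Alpha i, Delta i] \<in> carrier (complete_path_algebra X7)"
    "path_monomial (2 * i - 1) [Delta i, Gamma i] \<in> carrier (complete_path_algebra X7)"
    using assms by (auto intro!: path_monomial_carrier simp: X7_paths)
  have "path_monomial (2 * i) [Gamma i, Alpha i] \<in> Jacobian_relations t"
    using cyclic_derivative_Jacobian_relations[of "Beta i" t] assms
    by (simp add: X7_cyclic_derivatives(3)[OF ijk])
  from ideal_mult_closed(2)[OF ideal_Jacobian_relations ideal_mult_closed(1)[OF ideal_Jacobian_relations this c(1)] c(2)]
  show ?thesis
    by (simp add: X7_mult_simps Delta_monomial_def Delta_word_def)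
qed

text \<open>The derivative at \<open>Alpha i\<close> times \<open>Alpha i\<close> on the left and
  the one at \<open>Gamma i\<close> times \<open>Gamma i\<close> on the right share the term through
  \<open>Beta i\<close>, which cancels in the difference.\<close>

lemma Delta_commutation_relation:
  assumes ijk: "(i, j, k) \<in> cyclic_triples"
  shows "(\<lambda>s. (Delta_monomial [i, j] s + Delta_monomial [i, k] s + t * Delta_monomial [i, j, k] s)
      - (Delta_monomial [j, i] s + Delta_monomial [k, i] s + t * Delta_monomial [j, k, i] s)) \<in> Jacobian_relations t"
proof -
  have i: "i \<in> {1, 2, 3}" using cyclic_triples_range[OF ijk] by simp
  have c: "path_monomial 0 [Alpha i] \<in> carrier (complete_path_algebra X7)"
    "path_monomial (2 * i) [Gamma i] \<in> carrier (complete_path_algebra X7)"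
    using i by (auto intro!: path_monomial_carrier simp: X7_paths)
  have "path_series_mult X7 (path_monomial 0 [Alpha i]) (cyclic_derivative X7 (Alpha i) (X7_W t)) \<in> Jacobian_relations t"
    "path_series_mult X7 (cyclic_derivative X7 (Gamma i) (X7_W t)) (path_monomial (2 * i) [Gamma i]) \<in> Jacobian_relations t"
    using i by (intro ideal_mult_closed[OF ideal_Jacobian_relations] c cyclic_derivative_Jacobian_relations; simp)+
  from ideal_minus_closed[OF ideal_Jacobian_relations wf_digraph_X7 this]
  show ?thesis
    unfolding X7_cyclic_derivatives[OF ijk]
    by (simp add: X7_mult_simps Delta_monomial_def Delta_word_def algebra_simps)
qed

text \<open>The derivative at \<open>Alpha i\<close>, completed by \<open>Alpha i\<close> on the
  left, has this cycle as its only term of length 3; the other terms have length 6 or 9. A passage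
  through \<open>Beta i\<close> can thus be traded for longer paths.\<close>

lemma B_monomial_order:
  fixes t :: "'k::field"
  assumes i: "i \<in> {1, 2, 3}"
  shows "path_monomial 0 [Alpha i, Beta i, Gamma i] \<in>
    Jacobian_relations t <+>\<^bsub>complete_path_algebra X7\<^esub> order_ideal X7 6"
proof -
  let ?A = "complete_path_algebra X7 :: 'k X7_series ring"
  obtain j k where ijk: "(i, j, k) \<in> cyclic_triples" using cyclic_triples_ex[OF i] by blast
  have c: "path_monomial 0 [Alpha i] \<in> carrier ?A"
    "path_monomial 0 [Alpha i, Beta i, Gamma i] \<in> carrier ?A"
    using i by (auto intro!: path_monomial_carrier simp: X7_paths)
  have "path_series_mult X7 (path_monomial 0 [Alpha i]) (cyclic_derivative X7 (Alpha i) (X7_W t)) \<in> Jacobian_relations t"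
    using i by (intro ideal_mult_closed[OF ideal_Jacobian_relations] c cyclic_derivative_Jacobian_relations) simp
  moreover have "length p < 6 \<longrightarrow> path_monomial 0 [Alpha i, Beta i, Gamma i] (u, p) =
      path_series_mult X7 (path_monomial 0 [Alpha i]) (cyclic_derivative X7 (Alpha i) (X7_W t)) (u, p)" for u p
    unfolding X7_cyclic_derivatives[OF ijk]
    by (simp add: X7_mult_simps Delta_word_def) (auto simp: path_monomial_def)
  ultimately show ?thesis
    unfolding order_ideal_add_iff[OF wf_digraph_X7 ideal_Jacobian_relations]
    using c(2) by blast
qed

section \<open>Decomposition of paths into cycles at the vertex 0\<close>

lemma X7_arc_cases:
  assumes "a \<in> arcs X7"
  obtains i where "i \<in> {1, 2, 3}" "a = Alpha i" | i where "i \<in> {1, 2, 3}" "a = Beta i"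
    | i where "i \<in> {1, 2, 3}" "a = Gamma i" | i where "i \<in> {1, 2, 3}" "a = Delta i"
  using assms by (auto simp: X7_def)

lemma X7_tail_0: "a \<in> arcs X7 \<Longrightarrow> X7_tail a = 0 \<Longrightarrow> \<exists>i\<in>{1, 2, 3}. a = Alpha i"
  by (erule X7_arc_cases) auto

lemma X7_tail_odd:
  "a \<in> arcs X7 \<Longrightarrow> i \<in> {1, 2, 3} \<Longrightarrow> X7_tail a = 2 * i - 1 \<Longrightarrow> a = Beta i \<or> a = Delta i"
  by (erule X7_arc_cases; elim insertE emptyE; simp)

lemma X7_tail_even: "a \<in> arcs X7 \<Longrightarrow> i \<in> {1, 2, 3} \<Longrightarrow> X7_tail a = 2 * i \<Longrightarrow> a = Gamma i"
  by (erule X7_arc_cases; elim insertE emptyE; simp)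

lemma X7_path_from_0:
  assumes "(0, p) \<in> quiver_paths X7" "3 \<le> length p"
  obtains i m q where "i \<in> {1, 2, 3}" "m = Beta i \<or> m = Delta i" "p = [Alpha i, m, Gamma i] @ q"
    "(0, q) \<in> quiver_paths X7"
proof -
  obtain a b c q where p: "p = a # b # c # q"
    using assms(2) by (auto simp: numeral_eq_Suc Suc_le_length_iff)
  from assms(1) obtain v where arcs: "a \<in> arcs X7" "b \<in> arcs X7" "c \<in> arcs X7" "set q \<subseteq> arcs X7"
    and t: "X7_tail a = 0" "X7_tail b = X7_head a" "X7_tail c = X7_head b" "pre_digraph.cas X7 (X7_head c) q v"
    unfolding X7_paths p by auto
  obtain i where i: "i \<in> {1, 2, 3}" and a: "a = Alpha i" using X7_tail_0[OF arcs(1) t(1)] by blast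
  have b: "b = Beta i \<or> b = Delta i" using X7_tail_odd[OF arcs(2) i] t(2) a by simp
  have c: "c = Gamma i" using X7_tail_even[OF arcs(3) i] t(3) b by auto
  show thesis
    by (rule that[OF i b]) (use p a c arcs t in \<open>auto simp: X7_paths\<close>)
qed

text \<open>Two arrows lead from an odd vertex to 0 and one arrow from a nonzero even vertex, so
  \<open>p1\<close> is the start of the path before it visits 0.\<close>

lemma X7_path_through_0:
  assumes "(u, p) \<in> quiver_paths X7" "2 \<le> length p"
  obtains p1 p2 where "p = p1 @ p2" "length p1 \<le> 2" "pre_digraph.awlast X7 u p1 = 0"
    "(u, p1) \<in> quiver_paths X7" "(0, p2) \<in> quiver_paths X7"
proof -
  obtain a b q where p: "p = a # b # q"
    using assms(2) by (auto simp: numeral_eq_Suc Suc_le_length_iff)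
  have "\<exists>k\<le>2. pre_digraph.awlast X7 u (take k p) = 0"
  proof -
    have ab: "a \<in> arcs X7" "b \<in> arcs X7" "X7_tail a = u" "X7_tail b = X7_head a"
      using assms(1) unfolding X7_paths p by auto
    from ab(1) show ?thesis
    proof (cases rule: X7_arc_cases)
      case (1 i)
      then show ?thesis using ab by (intro exI[of _ 0]) (simp add: X7_awlast)
    next
      case (3 i)
      then show ?thesis using ab by (intro exI[of _ 1]) (simp add: X7_awlast p)
    next
      case (2 i)
      then show ?thesis using ab X7_tail_even[of b i] by (intro exI[of _ 2]) (simp add: X7_awlast p)
    next
      case (4 i)
      then show ?thesis using ab X7_tail_even[of b i] by (intro exI[of _ 2]) (simp add: X7_awlast p)
    qed
  qed
  then obtain k where k: "k \<le> 2" "pre_digraph.awlast X7 u (take k p) = 0" by blast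
  show thesis
    by (rule that[of "take k p" "drop k p"])
      (use k assms(1) quiver_paths_take_drop[OF wf_digraph_X7, of u p k] in auto)
qed

text \<open>A path from 0 runs through cycles of three arrows, each containing a
  \<open>Beta i\<close> or a \<open>Delta i\<close>. Cycles are split off until there are
  \<open>k\<close> of the second kind or one of the first kind appears.\<close>

lemma X7_path_blocks:
  assumes "(0, p) \<in> quiver_paths X7" "3 * k \<le> length p"
  shows "(\<exists>w q. length w = k \<and> set w \<subseteq> {1, 2, 3} \<and> p = concat (map Delta_word w) @ q \<and>
      (0, q) \<in> quiver_paths X7) \<or>
    (\<exists>w i q. set w \<subseteq> {1, 2, 3} \<and> i \<in> {1, 2, 3} \<and>
      p = concat (map Delta_word w) @ [Alpha i, Beta i, Gamma i] @ q \<and> (0, q) \<in> quiver_paths X7)"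
  using assms
proof (induction k arbitrary: p)
  case (Suc k)
  from Suc.prems(2) have "3 \<le> length p" by simp
  with Suc.prems(1) obtain i m q where i: "i \<in> {1, 2, 3}" and m: "m = Beta i \<or> m = Delta i"
    and p: "p = [Alpha i, m, Gamma i] @ q" and q: "(0, q) \<in> quiver_paths X7"
    by (rule X7_path_from_0)
  show ?case
  proof (cases "m = Beta i")
    case True
    then show ?thesis using i p q by (intro disjI2 exI[of _ "[]"] exI[of _ i] exI[of _ q]) simp
  next
    case False
    then have p': "p = Delta_word i @ q" using m p by (simp add: Delta_word_def)
    have "3 * k \<le> length q" using Suc.prems(2) p by simp
    from Suc.IH[OF q this] show ?thesis
    proof (elim disjE exE conjE)
      fix w r assume "length w = k" "set w \<subseteq> {1, 2, 3}" "q = concat (map Delta_word w) @ r"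
        "(0, r) \<in> quiver_paths X7"
      then show ?thesis
        using i p' by (intro disjI1 exI[of _ "i # w"] exI[of _ r]) simp
    next
      fix w j r assume "set w \<subseteq> {1, 2, 3}" "j \<in> {1, 2, 3}"
        "q = concat (map Delta_word w) @ [Alpha j, Beta j, Gamma j] @ r" "(0, r) \<in> quiver_paths X7"
      then show ?thesis
        using i p' by (intro disjI2 exI[of _ "i # w"] exI[of _ j] exI[of _ r]) simp
    qed
  qed
qed simp

lemma X7_monomial_mult3:
  assumes "pre_digraph.awlast X7 u p = 0" "pre_digraph.awlast X7 0 q = 0"
  shows "path_monomial u (p @ q @ r) =
    path_series_mult X7 (path_monomial u p) (path_series_mult X7 (path_monomial 0 q) (path_monomial 0 r))"
  by (simp add: path_monomial_mult[OF assms(1), unfolded complete_path_algebra_simps]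
      path_monomial_mult[OF assms(2), unfolded complete_path_algebra_simps])

text \<open>In the bound \<open>3 * k + 2\<close> the 2 pays for the start of the path before the
  vertex 0. What follows contains either a word of \<open>k\<close> cycles, which gains at least one
  arrow by assumption, or a cycle through \<open>Beta i\<close>, whose length 3 is raised to at
  least 6.\<close>

lemma X7_long_path:
  fixes t :: "'k::field"
  assumes zero: "\<And>w. length w = k \<Longrightarrow> set w \<subseteq> {1, 2, 3} \<Longrightarrow>
      Delta_monomial w \<in> Jacobian_relations t <+>\<^bsub>complete_path_algebra X7\<^esub> order_ideal X7 (3 * k + 1)"
    and p: "(u, p) \<in> quiver_paths X7" "3 * k + 2 \<le> length p"
  shows "path_monomial u p \<in>
    Jacobian_relations t <+>\<^bsub>complete_path_algebra X7\<^esub> order_ideal X7 (Suc (length p))"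
proof -
  let ?A = "complete_path_algebra X7 :: 'k X7_series ring"
  let ?J = "\<lambda>n. Jacobian_relations t <+>\<^bsub>?A\<^esub> order_ideal X7 n"
  note mul = order_ideal_add_mult[OF wf_digraph_X7 ideal_Jacobian_relations]
  have combine: "path_monomial u (p @ q @ r) \<in> ?J (length p + (n + length r))"
    if "path_monomial 0 q \<in> ?J n" "(u, p) \<in> quiver_paths X7" "(0, r) \<in> quiver_paths X7"
      "pre_digraph.awlast X7 u p = 0" "pre_digraph.awlast X7 0 q = 0" for u p q r n
    unfolding X7_monomial_mult3[OF that(4,5)]
    by (intro mul that(1) path_monomial_order_ideal that(2,3) order_refl)
  obtain p1 p2 where p12: "p = p1 @ p2" "length p1 \<le> 2" "pre_digraph.awlast X7 u p1 = 0"
    "(u, p1) \<in> quiver_paths X7" "(0, p2) \<in> quiver_paths X7"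
    using X7_path_through_0[OF p(1)] p(2) by auto
  have last: "pre_digraph.awlast X7 0 (concat (map Delta_word w)) = 0" for w
    using concat_Delta_word_last[of w] by (cases "w = []") (simp_all add: X7_awlast)
  have "3 * k \<le> length p2" using p p12 by simp
  from X7_path_blocks[OF p12(5) this] show ?thesis
  proof (elim disjE exE conjE)
    fix w q assume w: "length w = k" "set w \<subseteq> {1, 2, 3}" and p2: "p2 = concat (map Delta_word w) @ q"
      and q: "(0, q) \<in> quiver_paths X7"
    have "path_monomial u (p1 @ concat (map Delta_word w) @ q) \<in> ?J (length p1 + (3 * k + 1 + length q))"
      using zero[OF w] p12 q last unfolding Delta_monomial_def by (intro combine) auto
    moreover have "length p1 + (3 * k + 1 + length q) = Suc (length p)"
      using p12(1) p2 Delta_words_length[of w] w by simp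
    ultimately show ?thesis using p12(1) p2 by simp
  next
    fix w i q assume w: "set w \<subseteq> {1, 2, 3}" and i: "i \<in> {1, 2, 3}"
      and p2: "p2 = concat (map Delta_word w) @ [Alpha i, Beta i, Gamma i] @ q"
      and q: "(0, q) \<in> quiver_paths X7"
    let ?p = "p1 @ concat (map Delta_word w)"
    have pp: "p = ?p @ [Alpha i, Beta i, Gamma i] @ q" using p12(1) p2 by simp
    have "(u, ?p) \<in> quiver_paths X7"
      using p(1) quiver_paths_take_drop[OF wf_digraph_X7, of u p "length ?p"] by (simp add: pp)
    moreover have "pre_digraph.awlast X7 u ?p = 0"
      using p12(3) last[of w] by (subst awlast_append) simp
    moreover have "pre_digraph.awlast X7 0 [Alpha i, Beta i, Gamma i] = 0" by (simp add: X7_awlast)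
    ultimately have "path_monomial u (?p @ [Alpha i, Beta i, Gamma i] @ q) \<in> ?J (length ?p + (6 + length q))"
      using q by (intro combine B_monomial_order[OF i])
    then have "path_monomial u p \<in> ?J (length ?p + (6 + length q))" by (simp only: pp)
    then show ?thesis
      by (rule order_ideal_add_mono[OF wf_digraph_X7 ideal_Jacobian_relations, rotated])
        (simp add: pp)
  qed
qed

lemma X7_potential: "X7_W t \<in> potentials X7"
  using X7_potentials(1)
  by (auto simp: potentials_def X7_W_def path_monomial_def Delta_word_def quiver_cycles_def X7_awalk)

text \<open>A word of \<open>k\<close> cycles has length \<open>3 * k\<close>, so the assumption
  asks for a gain of a single arrow.\<close>

lemma finite_dim_X7I:
  assumes "\<And>w. length w = k \<Longrightarrow> set w \<subseteq> {1, 2, 3} \<Longrightarrow>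
      Delta_monomial w \<in> Jacobian_relations t <+>\<^bsub>complete_path_algebra X7\<^esub> order_ideal X7 (3 * k + 1)"
  shows "finite_dim_jacobian_algebra X7 (X7_W t)"
proof (rule finite_dim_jacobian_algebraI[OF fin_digraph_X7 _ X7_potential])
  show "verts X7 \<noteq> {}" by (simp add: X7_def)
  show "order_ideal X7 (3 * k + 2) \<subseteq> jacobian_ideal X7 (X7_W t)"
    using order_ideal_subset_closure[OF fin_digraph_X7 ideal_Jacobian_relations X7_long_path[OF assms]]
    unfolding jacobian_ideal_def Jacobian_relations_def .
qed

section \<open>Vanishing of long words\<close>

text \<open>For \<open>t = 1\<close> the relations hold exactly in the quotient by the ideal. The
  ring argument for involutions therefore applies there and places the word in the ideal
  itself.\<close>

lemma Delta_monomial_mod_char2: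
  fixes w :: "nat list"
  assumes char: "CHAR('k::field) = 2" and w: "length w = 8" "set w \<subseteq> {1, 2, 3}"
  shows "Delta_monomial w \<in> Jacobian_relations (1::'k)"
proof -
  let ?A = "complete_path_algebra X7 :: 'k X7_series ring"
  let ?I = "Jacobian_relations (1::'k)"
  let ?R = "?A Quot ?I"
  interpret A: ring ?A by (rule ring_complete_path_algebra[OF wf_digraph_X7])
  interpret I: ideal ?I ?A by (rule ideal_Jacobian_relations)
  interpret R: ring ?R by (rule I.quotient_is_ring)
  define h where "h = (+>\<^bsub>?A\<^esub>) ?I"
  interpret h: ring_hom_ring ?A ?R h unfolding h_def by (rule I.rcos_ring_hom_ring)
  define d where "d v = h (Delta_monomial v)" for v
  have d_carrier: "d v \<in> carrier ?R" if "set v \<subseteq> {1, 2, 3}" for v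
    unfolding d_def by (intro h.hom_closed Delta_monomial_carrier that)
  have d_append: "d (v @ v') = d v \<otimes>\<^bsub>?R\<^esub> d v'" if "set v \<subseteq> {1, 2, 3}" "set v' \<subseteq> {1, 2, 3}" for v v'
    unfolding d_def h.hom_mult[OF Delta_monomial_carrier[OF that(1)] Delta_monomial_carrier[OF that(2)], symmetric]
    by (simp add: complete_path_algebra_simps Delta_monomial_mult)
  have d_Cons: "d (i # v) = d [i] \<otimes>\<^bsub>?R\<^esub> d v" if "i \<in> {1, 2, 3}" "set v \<subseteq> {1, 2, 3}" for i v
    using d_append[of "[i]" v] that by simp
  have h_zero: "h f = \<zero>\<^bsub>?R\<^esub>" if "f \<in> ?I" for f
    using I.a_rcos_const[OF that] by (simp add: h_def FactRing_def)
  have car: "d [i] \<in> carrier ?R" if "i \<in> {1, 2, 3}" for i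
    using d_carrier[of "[i]"] that by simp
  have two: "\<one>\<^bsub>?R\<^esub> \<oplus>\<^bsub>?R\<^esub> \<one>\<^bsub>?R\<^esub> = \<zero>\<^bsub>?R\<^esub>"
  proof -
    have "(1::'k) + 1 = 0" using char of_nat_CHAR[where 'a = 'k] by simp
    then have "\<one>\<^bsub>?A\<^esub> \<oplus>\<^bsub>?A\<^esub> \<one>\<^bsub>?A\<^esub> = \<zero>\<^bsub>?A\<^esub>"
      by (auto simp: complete_path_algebra_simps path_series_scalar_def fun_eq_iff)
    then show ?thesis using h.hom_add[OF A.one_closed A.one_closed] by simp
  qed
  have sq: "d [i] \<otimes>\<^bsub>?R\<^esub> d [i] = \<zero>\<^bsub>?R\<^esub>" if "i \<in> {1, 2, 3}" for i
    using d_append[of "[i]" "[i]"] h_zero[OF Delta_square_relation[OF that]] that by (simp add: d_def)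
  have comm: "d [i] \<otimes>\<^bsub>?R\<^esub> (d [j] \<oplus>\<^bsub>?R\<^esub> d [k] \<oplus>\<^bsub>?R\<^esub> d [j] \<otimes>\<^bsub>?R\<^esub> d [k]) =
      (d [j] \<oplus>\<^bsub>?R\<^esub> d [k] \<oplus>\<^bsub>?R\<^esub> d [j] \<otimes>\<^bsub>?R\<^esub> d [k]) \<otimes>\<^bsub>?R\<^esub> d [i]"
    if ijk: "(i, j, k) \<in> cyclic_triples" for i j k
  proof -
    have r: "i \<in> {1, 2, 3}" "j \<in> {1, 2, 3}" "k \<in> {1, 2, 3}" using cyclic_triples_range[OF ijk] by auto
    have mc: "Delta_monomial v \<in> carrier ?A" if "set v \<subseteq> {i, j, k}" for v
      using that r by (intro Delta_monomial_carrier) auto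
    let ?X = "Delta_monomial [j] \<oplus>\<^bsub>?A\<^esub> Delta_monomial [k] \<oplus>\<^bsub>?A\<^esub> Delta_monomial [j] \<otimes>\<^bsub>?A\<^esub> Delta_monomial [k]"
    have X: "?X \<in> carrier ?A" using mc[of "[j]"] mc[of "[k]"] by simp
    have "h (Delta_monomial [i] \<otimes>\<^bsub>?A\<^esub> ?X) = h (?X \<otimes>\<^bsub>?A\<^esub> Delta_monomial [i])"
      unfolding h_def
    proof (rule ideal_coset_eqI[OF wf_digraph_X7 ideal_Jacobian_relations])
      show "(\<lambda>s. (Delta_monomial [i] \<otimes>\<^bsub>?A\<^esub> ?X) s - (?X \<otimes>\<^bsub>?A\<^esub> Delta_monomial [i]) s) \<in> ?I"
        using Delta_commutation_relation[OF ijk, of 1]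
        by (simp add: complete_path_algebra_simps path_series_mult_add Delta_monomial_mult)
    qed (use X mc[of "[i]"] in simp_all)
    then show ?thesis
      using mc[of "[i]"] mc[of "[j]"] mc[of "[k]"] X by (simp add: d_def)
  qed
  obtain x1 x2 x3 x4 y1 y2 y3 y4 where w8: "w = [x1, x2, x3, x4, y1, y2, y3, y4]"
    using w(1) by (auto simp: numeral_eq_Suc length_Suc_conv)
  have x: "d [x] \<in> {d [1], d [2], d [3]}" if "x \<in> set w" for x
    using that w(2) by auto
  have "d w = d [x1] \<otimes>\<^bsub>?R\<^esub> (d [x2] \<otimes>\<^bsub>?R\<^esub> (d [x3] \<otimes>\<^bsub>?R\<^esub> (d [x4] \<otimes>\<^bsub>?R\<^esub> (d [y1] \<otimes>\<^bsub>?R\<^esub>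
      (d [y2] \<otimes>\<^bsub>?R\<^esub> (d [y3] \<otimes>\<^bsub>?R\<^esub> d [y4]))))))"
    using w(2) unfolding w8 by (simp add: d_Cons[of _ "_ # _"])
  also have "\<dots> = \<zero>\<^bsub>?R\<^esub>"
    by (rule R.char2_eight_prod_zero[of "d [1]" "d [2]" "d [3]"]; (intro car two sq comm x)?;
        simp add: w8 cyclic_triples_def)
  finally have "?I +>\<^bsub>?A\<^esub> Delta_monomial w = ?I" by (simp add: d_def h_def FactRing_def)
  then show ?thesis
    using I.a_rcos_self[OF Delta_monomial_carrier[OF w(2)]] by simp
qed

text \<open>A word of five cycles has length 15, whence the order 16. Inside a context of three
  letters the cubic terms of the commutation relation become words of six cycles, of length 18, so
  they vanish modulo \<open>order_ideal X7 16\<close> for every \<open>t\<close>.\<close>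

lemma Delta_monomial_mod_char_not_2:
  fixes t :: "'k::field" and w :: "nat list"
  assumes char: "CHAR('k) \<noteq> 2" and w: "length w = 5" "set w \<subseteq> {1, 2, 3}"
  shows "Delta_monomial w \<in>
    Jacobian_relations t <+>\<^bsub>complete_path_algebra X7\<^esub> order_ideal X7 16"
proof -
  let ?A = "complete_path_algebra X7 :: 'k X7_series ring"
  let ?I = "Jacobian_relations t <+>\<^bsub>?A\<^esub> order_ideal X7 16"
  let ?R = "?A Quot ?I"
  have idl: "ideal ?I ?A" by (rule ideal_add_order_ideal[OF wf_digraph_X7 ideal_Jacobian_relations])
  interpret A: ring ?A by (rule ring_complete_path_algebra[OF wf_digraph_X7])
  interpret I: ideal ?I ?A by (rule idl)
  interpret R: ring ?R by (rule I.quotient_is_ring)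
  define h where "h = (+>\<^bsub>?A\<^esub>) ?I"
  interpret h: ring_hom_ring ?A ?R h unfolding h_def by (rule I.rcos_ring_hom_ring)
  have h_zero: "h f = \<zero>\<^bsub>?R\<^esub>" if "f \<in> ?I" for f
    using I.a_rcos_const[OF that] by (simp add: h_def FactRing_def)
  have zero_h: "f \<in> ?I" if "h f = \<zero>\<^bsub>?R\<^esub>" "f \<in> carrier ?A" for f
    using that I.a_rcos_self[OF that(2)] by (simp add: h_def FactRing_def)
  have rel: "f \<in> ?I" if "f \<in> Jacobian_relations t" for f
    unfolding order_ideal_add_iff[OF wf_digraph_X7 ideal_Jacobian_relations]
    using that ideal.Icarr[OF ideal_Jacobian_relations that] by blast
  have ord: "f \<in> ?I" if "f \<in> order_ideal X7 16" for f
    unfolding order_ideal_add_iff[OF wf_digraph_X7 ideal_Jacobian_relations]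
    using that additive_subgroup.zero_closed[OF ideal.axioms(1)[OF ideal_Jacobian_relations[of t]]]
    by (auto simp: order_ideal_def complete_path_algebra_simps)
  have two: "(2::'k) \<noteq> 0"
  proof
    assume "(2::'k) = 0"
    then have "of_nat 2 = (0::'k)" by simp
    then have "CHAR('k) dvd 2" using of_nat_eq_0_iff_char_dvd by blast
    then have "CHAR('k) \<le> 2" "CHAR('k) \<noteq> 0" by (auto dest: dvd_imp_le intro: Nat.gr0I)
    moreover have "CHAR('k) \<noteq> 1" by simp
    ultimately show False using char by linarith
  qed
  \<comment> \<open>The default 0 makes \<open>f\<close> total on words; with a foreign letter in
    the context all relations read 0 = 0.\<close>
  define f where "f v = (if set v \<subseteq> {1, 2, 3} then h (Delta_monomial v) else \<zero>\<^bsub>?R\<^esub>)" for v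
  have "f w = \<zero>\<^bsub>?R\<^esub>"
  proof (rule R.five_words_zero[OF _ _ _ _ w])
    show "f v \<in> carrier ?R" for v
      unfolding f_def by (simp add: Delta_monomial_carrier)
  next
    fix x assume x: "x \<in> carrier ?R" and xx: "x \<oplus>\<^bsub>?R\<^esub> x = \<zero>\<^bsub>?R\<^esub>"
    obtain y where y: "y \<in> carrier ?A" "x = h y"
      using x unfolding h_def FactRing_def A_RCOSETS_defs a_r_coset_def by auto
    then have "y \<oplus>\<^bsub>?A\<^esub> y \<in> ?I" using xx by (intro zero_h) simp_all
    \<comment> \<open>The scalar \<open>1 / 2\<close> recovers \<open>y\<close> from
      \<open>y + y\<close>.\<close>
    from ideal_mult_closed(1)[OF idl this path_series_scalar_carrier[OF wf_digraph_X7, of "1 / 2"]]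
    have "y \<in> ?I"
      using path_series_scalar_mult(1)[OF wf_digraph_X7, OF A.a_closed[OF y(1) y(1)], of "1 / 2"] two
      by (simp add: complete_path_algebra_simps)
    then show "x = \<zero>\<^bsub>?R\<^esub>" using h_zero y by simp
  next
    fix p q :: "nat list" and x :: nat
    show "f (p @ [x, x] @ q) = \<zero>\<^bsub>?R\<^esub>"
    proof (cases "set (p @ [x, x] @ q) \<subseteq> {1, 2, 3}")
      case True
      then have "x \<in> {1, 2, 3}" "set p \<subseteq> {1, 2, 3}" "set q \<subseteq> {1, 2, 3}" by auto
      then have "path_series_mult X7 (Delta_monomial p) (path_series_mult X7 (Delta_monomial [x, x]) (Delta_monomial q)) \<in> ?I"
        by (intro ideal_mult_closed[OF idl] rel Delta_square_relation Delta_monomial_carrier)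
      then show ?thesis using h_zero by (simp add: f_def Delta_monomial_mult)
    qed (auto simp: f_def)
  next
    fix p q :: "nat list" and x y z :: nat
    assume len: "length p + length q = 3" and xyz: "{x, y, z} = {1, 2, 3}"
    show "f (p @ [x, y] @ q) \<oplus>\<^bsub>?R\<^esub> f (p @ [x, z] @ q) = f (p @ [y, x] @ q) \<oplus>\<^bsub>?R\<^esub> f (p @ [z, x] @ q)"
    proof (cases "set p \<subseteq> {1, 2, 3} \<and> set q \<subseteq> {1, 2, 3}")
      case True
      then have pq: "set p \<subseteq> {1, 2, 3}" "set q \<subseteq> {1, 2, 3}" by auto
      have "f (p @ [i, j] @ q) \<oplus>\<^bsub>?R\<^esub> f (p @ [i, k] @ q) = f (p @ [j, i] @ q) \<oplus>\<^bsub>?R\<^esub> f (p @ [k, i] @ q)"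
        if ijk: "(i, j, k) \<in> cyclic_triples" for i j k
      proof -
        have r: "i \<in> {1, 2, 3}" "j \<in> {1, 2, 3}" "k \<in> {1, 2, 3}" using cyclic_triples_range[OF ijk] by auto
        let ?m = "\<lambda>v. Delta_monomial (p @ v @ q) :: 'k X7_series"
        have mc: "?m v \<in> carrier ?A" if "set v \<subseteq> {i, j, k}" for v
          using that r pq by (intro Delta_monomial_carrier) auto
        have "path_series_mult X7 (Delta_monomial p) (path_series_mult X7 (\<lambda>s.
            (Delta_monomial [i, j] s + Delta_monomial [i, k] s + t * Delta_monomial [i, j, k] s) -
            (Delta_monomial [j, i] s + Delta_monomial [k, i] s + t * Delta_monomial [j, k, i] s)) (Delta_monomial q)) \<in> ?I"
          using pq by (intro ideal_mult_closed[OF idl] rel Delta_commutation_relation[OF ijk] Delta_monomial_carrier)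
        then have 1: "(\<lambda>s. (?m [i, j] s + ?m [i, k] s + t * ?m [i, j, k] s) -
            (?m [j, i] s + ?m [k, i] s + t * ?m [j, k, i] s)) \<in> ?I"
          by (simp add: path_series_mult_add path_series_mult_smult Delta_monomial_mult)
        have "?m v \<in> order_ideal X7 16" if "set v \<subseteq> {i, j, k}" "length v = 3" for v
        proof -
          have "set (p @ v @ q) \<subseteq> {1, 2, 3}" using that r pq by auto
          from Delta_monomial_order[OF this] show ?thesis
            using len that(2) by (auto simp: order_ideal_def)
        qed
        from this[of "[i, j, k]"] this[of "[j, k, i]"]
        have 2: "(\<lambda>s. t * ?m [i, j, k] s - t * ?m [j, k, i] s) \<in> ?I"
          by (intro ord) (auto simp: order_ideal_def complete_path_algebra_carrier)
        have 3: "(\<lambda>s. (?m [i, j] \<oplus>\<^bsub>?A\<^esub> ?m [i, k]) s - (?m [j, i] \<oplus>\<^bsub>?A\<^esub> ?m [k, i]) s) \<in> ?I"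
          using ideal_minus_closed[OF idl wf_digraph_X7 1 2]
          by (simp add: complete_path_algebra_simps algebra_simps)
        have "h (?m [i, j] \<oplus>\<^bsub>?A\<^esub> ?m [i, k]) = h (?m [j, i] \<oplus>\<^bsub>?A\<^esub> ?m [k, i])"
          unfolding h_def
          by (rule ideal_coset_eqI[OF wf_digraph_X7 idl _ _ 3]) (intro A.a_closed mc; auto)+
        then show ?thesis
          using mc[of "[i, j]"] mc[of "[i, k]"] mc[of "[j, i]"] mc[of "[k, i]"] r pq
          by (simp add: f_def)
      qed
      note c = this
      have fc: "f v \<in> carrier ?R" for v
        unfolding f_def by (simp add: Delta_monomial_carrier)
      \<comment> \<open>Without the cubic terms the relation is symmetric in its last two indices,
        so either orientation of the triple yields it.\<close>
      have "(x, y, z) \<in> cyclic_triples \<or> (x, z, y) \<in> cyclic_triples"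
      proof -
        have "card {x, y, z} = 3" unfolding xyz by simp
        then have "x \<noteq> y" "x \<noteq> z" "y \<noteq> z" by (auto simp: card_insert_if split: if_splits)
        moreover have "x \<in> {1, 2, 3}" "y \<in> {1, 2, 3}" "z \<in> {1, 2, 3}"
          unfolding xyz[symmetric] by simp_all
        ultimately show ?thesis unfolding cyclic_triples_def by auto
      qed
      then show ?thesis
      proof
        assume "(x, z, y) \<in> cyclic_triples"
        from c[OF this] show ?thesis
          by (simp only: R.a_comm[OF fc[of "p @ [x, y] @ q"] fc[of "p @ [x, z] @ q"]]
              R.a_comm[OF fc[of "p @ [y, x] @ q"] fc[of "p @ [z, x] @ q"]])
      qed (rule c)
    next
      case False
      then have "f (p @ v @ q) = \<zero>\<^bsub>?R\<^esub>" for v by (auto simp: f_def)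
      then show ?thesis by (simp only:)
    qed
  qed
  then have "h (Delta_monomial w) = \<zero>\<^bsub>?R\<^esub>" using w(2) by (simp add: f_def)
  then show ?thesis using Delta_monomial_carrier[OF w(2)] by (rule zero_h)
qed

lemma finite_dim_X7_char_not_2:
  fixes t :: "'k::field"
  assumes "CHAR('k) \<noteq> 2"
  shows "finite_dim_jacobian_algebra X7 (X7_W t)"
  by (rule finite_dim_X7I[of 5]) (simp add: Delta_monomial_mod_char_not_2[OF assms])

lemma finite_dim_X7_char_2:
  assumes "CHAR('k::field) = 2"
  shows "finite_dim_jacobian_algebra X7 (X7_W (1::'k))"
proof (rule finite_dim_X7I[of 8])
  fix w :: "nat list" assume "length w = 8" "set w \<subseteq> {1, 2, 3}"
  from Delta_monomial_mod_char2[OF assms this]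
  show "Delta_monomial w \<in> Jacobian_relations (1::'k) <+>\<^bsub>complete_path_algebra X7\<^esub> order_ideal X7 (3 * 8 + 1)"
    unfolding order_ideal_add_iff[OF wf_digraph_X7 ideal_Jacobian_relations]
    using ideal.Icarr[OF ideal_Jacobian_relations] by blast
qed

section \<open>A graded matrix representation in characteristic 2\<close>

text \<open>
  Rows and columns are indexed by 0 and 1.  \<open>Alpha n\<close> is a column \<open>x\<close> and \<open>Gamma n\<close> a row \<open>y\<close> with
  \<open>xy = E\<^sub>1\<^sub>2\<close>, \<open>xy = E\<^sub>2\<^sub>1\<close> and \<open>xy\<close> the all-ones matrix for \<open>n = 1, 2, 3\<close>, both padded with zeros to
  square matrices in order to have the same format for all arrows.
\<close>

fun X7_matrix :: "X7_arrow \<Rightarrow> nat \<Rightarrow> nat \<Rightarrow> 'k::field" where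
  "X7_matrix (Alpha n) i j = (if j = 0 \<and> (n = 3 \<or> n = i + 1) then 1 else 0)"
| "X7_matrix (Gamma n) i j = (if i = 0 \<and> (n = 3 \<or> n + j = 2) then 1 else 0)"
| "X7_matrix (Beta n) i j = (if i = j then 1 else 0)"
| "X7_matrix (Delta n) i j = (if i = j then 1 else 0)"

fun path_matrix :: "X7_arrow list \<Rightarrow> nat \<Rightarrow> nat \<Rightarrow> 'k::field" where
  "path_matrix [] i j = (if i = j then 1 else 0)"
| "path_matrix (a # p) i j = (\<Sum>k<2. X7_matrix a i k * path_matrix p k j)"

text \<open>These weights make \<open>X7_W0\<close> homogeneous of weight 6. They bound the length
  from above, so there are only finitely many paths of each weight.\<close>

fun X7_weight :: "X7_arrow \<Rightarrow> nat" where
  "X7_weight (Beta n) = 4"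
| "X7_weight (Alpha n) = 1"
| "X7_weight (Gamma n) = 1"
| "X7_weight (Delta n) = 1"

definition path_weight :: "X7_arrow list \<Rightarrow> nat" where
  "path_weight p = sum_list (map X7_weight p)"

lemma path_weight_simps [simp]:
  "path_weight [] = 0" "path_weight (a # p) = X7_weight a + path_weight p"
  "path_weight (p @ q) = path_weight p + path_weight q"
  by (simp_all add: path_weight_def)

lemma length_le_path_weight: "length p \<le> path_weight p"
proof (induction p)
  case (Cons a p)
  then show ?case by (cases a) auto
qed simp

lemma sum_lessThan_2: "(\<Sum>k<2. f k) = f 0 + f (1::nat)"
  by (simp add: numeral_2_eq_2)

lemma path_matrix_append:
  assumes "i < 2"
  shows "path_matrix (p @ q) i j = (\<Sum>k<2. path_matrix p i k * path_matrix q k j)"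
  using assms
proof (induction p arbitrary: i)
  case Nil
  then have "i = 0 \<or> i = 1" by auto
  then show ?case by (auto simp: sum_lessThan_2)
next
  case (Cons a p)
  then show ?case by (simp add: sum_lessThan_2 algebra_simps)
qed

definition weighted_paths :: "nat \<Rightarrow> nat \<Rightarrow> nat \<Rightarrow> X7_arrow list set" where
  "weighted_paths u v n = {p. pre_digraph.awalk X7 u p v \<and> path_weight p = n}"

text \<open>Entry \<open>(i, j)\<close> of the weight \<open>n\<close> part of the block from
  \<open>u\<close> to \<open>v\<close> in the matrix representation. Fixing the weight keeps the sum
  finite for infinite series.\<close>

definition matrix_coeff :: "'k::field X7_series \<Rightarrow> nat \<Rightarrow> nat \<Rightarrow> nat \<Rightarrow> nat \<Rightarrow> nat \<Rightarrow> 'k" where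
  "matrix_coeff f u v n i j = (\<Sum>p\<in>weighted_paths u v n. f (u, p) * path_matrix p i j)"

lemma finite_weighted_paths: "finite (weighted_paths u v n)"
proof (rule finite_subset)
  show "weighted_paths u v n \<subseteq> {p. set p \<subseteq> arcs X7 \<and> length p \<le> n}"
    using length_le_path_weight by (auto simp: weighted_paths_def X7_awalk)
  show "finite {p. set p \<subseteq> arcs X7 \<and> length p \<le> n}"
    by (intro finite_lists_length_le) (simp add: X7_def)
qed

lemma X7_awlast_awalk: "pre_digraph.awalk X7 u p v \<Longrightarrow> pre_digraph.awlast X7 u p = v"
proof -
  have "pre_digraph.cas X7 u p v \<Longrightarrow> (if p = [] then u else X7_head (last p)) = v"
    by (induction p arbitrary: u) (auto split: if_splits)
  then show "pre_digraph.awalk X7 u p v \<Longrightarrow> pre_digraph.awlast X7 u p = v"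
    by (simp add: X7_awlast X7_awalk)
qed

lemma X7_awalk_append: "pre_digraph.awalk X7 u (p @ q) v \<longleftrightarrow>
   pre_digraph.awalk X7 u p (pre_digraph.awlast X7 u p) \<and>
   pre_digraph.awalk X7 (pre_digraph.awlast X7 u p) q v"
  by (rule wf_digraph.awalk_append_iff[OF wf_digraph_X7])

text \<open>The representation is multiplicative: vertices and matrix indices combine as in a
  product of block matrices, weights as in a Cauchy product.\<close>

lemma matrix_coeff_mult:
  fixes f g :: "'k::field X7_series"
  assumes i: "i < 2"
  shows "matrix_coeff (path_series_mult X7 f g) u v n i j =
    (\<Sum>w\<le>6. \<Sum>m\<le>n. \<Sum>k<2. matrix_coeff f u w m i k * matrix_coeff g w v (n - m) k j)"
proof -
  let ?l = "pre_digraph.awlast X7"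
  define F where "F w q r = (\<Sum>k<2. f (u, q) * path_matrix q i k * (g (w, r) * path_matrix r k j))" for w q r
  have "matrix_coeff (path_series_mult X7 f g) u v n i j =
      (\<Sum>p\<in>weighted_paths u v n. \<Sum>l\<le>length p. F (?l u (take l p)) (take l p) (drop l p))"
    unfolding matrix_coeff_def path_series_mult_def prod.case F_def sum_distrib_right
  proof (intro sum.cong refl)
    fix p l
    show "f (u, take l p) * g (?l u (take l p), drop l p) * path_matrix p i j =
      (\<Sum>k<2. f (u, take l p) * path_matrix (take l p) i k *
        (g (?l u (take l p), drop l p) * path_matrix (drop l p) k j))"
      using path_matrix_append[OF i, of "take l p" "drop l p" j, where 'a = 'k]
      by (simp add: sum_lessThan_2 algebra_simps)
  qed
  also have "\<dots> = (\<Sum>(p, l)\<in>(SIGMA p:weighted_paths u v n. {..length p}).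
      F (?l u (take l p)) (take l p) (drop l p))"
    by (simp add: sum.Sigma finite_weighted_paths)
  also have "\<dots> = (\<Sum>(w, m, q, r)\<in>(SIGMA w:{..6}. SIGMA m:{..n}.
      weighted_paths u w m \<times> weighted_paths w v (n - m)). F w q r)"
  \<comment> \<open>A path with a cut corresponds to its two pieces, recorded together with the
    vertex at the cut and the weight of the first piece.\<close>
  proof (rule sum.reindex_bij_witness[of _ "\<lambda>(w, m, q, r). (q @ r, length q)"
        "\<lambda>(p, l). (?l u (take l p), path_weight (take l p), take l p, drop l p)"])
    fix x assume "x \<in> (SIGMA p:weighted_paths u v n. {..length p})"
    then obtain p l where x: "x = (p, l)" and p: "pre_digraph.awalk X7 u p v" "path_weight p = n" "l \<le> length p"
      by (auto simp: weighted_paths_def)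
    have w: "path_weight (take l p) + path_weight (drop l p) = n"
      using p(2) path_weight_simps(3)[of "take l p" "drop l p"] by simp
    have a: "pre_digraph.awalk X7 u (take l p) (?l u (take l p))"
      "pre_digraph.awalk X7 (?l u (take l p)) (drop l p) v"
      using p(1) X7_awalk_append[of u "take l p" "drop l p" v] by simp_all
    then have "?l u (take l p) \<le> 6" using X7_awalk by (metis atLeastAtMost_iff)
    with a w show "(case x of (p, l) \<Rightarrow> (?l u (take l p), path_weight (take l p), take l p, drop l p)) \<in>
       (SIGMA w:{..6}. SIGMA m:{..n}. weighted_paths u w m \<times> weighted_paths w v (n - m))"
      by (auto simp: x weighted_paths_def)
    show "(case case x of (p, l) \<Rightarrow> (?l u (take l p), path_weight (take l p), take l p, drop l p) of
        (w, m, q, r) \<Rightarrow> (q @ r, length q)) = x"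
      using p(3) by (simp add: x)
  next
    fix y assume "y \<in> (SIGMA w:{..6}. SIGMA m:{..n}. weighted_paths u w m \<times> weighted_paths w v (n - m))"
    then obtain w m q r where y: "y = (w, m, q, r)" and m: "m \<le> n" and
      q: "pre_digraph.awalk X7 u q w" "path_weight q = m" and
      r: "pre_digraph.awalk X7 w r v" "path_weight r = n - m"
      by (auto simp: weighted_paths_def)
    note l = X7_awlast_awalk[OF q(1)]
    show "(case y of (w, m, q, r) \<Rightarrow> (q @ r, length q)) \<in> (SIGMA p:weighted_paths u v n. {..length p})"
      using q r m l by (simp add: y weighted_paths_def X7_awalk_append)
    show "(case case y of (w, m, q, r) \<Rightarrow> (q @ r, length q) of
        (p, l) \<Rightarrow> (?l u (take l p), path_weight (take l p), take l p, drop l p)) = y"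
      using q l by (simp add: y)
  qed auto
  also have "\<dots> = (\<Sum>w\<le>6. \<Sum>m\<le>n. \<Sum>q\<in>weighted_paths u w m. \<Sum>r\<in>weighted_paths w v (n - m). F w q r)"
    by (simp add: sum.Sigma sum.cartesian_product finite_weighted_paths)
  also have "\<dots> = (\<Sum>w\<le>6. \<Sum>m\<le>n. \<Sum>k<2. matrix_coeff f u w m i k * matrix_coeff g w v (n - m) k j)"
  proof (intro sum.cong refl)
    fix w m
    show "(\<Sum>q\<in>weighted_paths u w m. \<Sum>r\<in>weighted_paths w v (n - m). F w q r) =
      (\<Sum>k<2. matrix_coeff f u w m i k * matrix_coeff g w v (n - m) k j)"
      unfolding F_def matrix_coeff_def sum_product sum_lessThan_2 sum.distrib ..
  qed
  finally show ?thesis .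
qed

definition matrix_kernel :: "'k::field X7_series set" where
  "matrix_kernel = {f \<in> carrier (complete_path_algebra X7).
     \<forall>u v n. \<forall>i<2. \<forall>j<2. matrix_coeff f u v n i j = 0}"

lemma matrix_coeff_add:
  "matrix_coeff (\<lambda>s. f s + g s) u v n i j = matrix_coeff f u v n i j + matrix_coeff g u v n i j"
  by (simp add: matrix_coeff_def algebra_simps sum.distrib)

lemma matrix_coeff_uminus: "matrix_coeff (\<lambda>s. - f s) u v n i j = - matrix_coeff f u v n i j"
  by (simp add: matrix_coeff_def sum_negf)

lemma matrix_coeff_smult: "matrix_coeff (\<lambda>s. c * f s) u v n i j = c * matrix_coeff f u v n i j"
  by (simp add: matrix_coeff_def sum_distrib_left mult_ac)

lemma matrix_coeff_monomial:
  "matrix_coeff (path_monomial u' p) u v n i j =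
    (if u = u' \<and> p \<in> weighted_paths u v n then path_matrix p i j else (0::'k::field))"
proof -
  have "matrix_coeff (path_monomial u' p) u v n i j =
      (\<Sum>q\<in>weighted_paths u v n. if q = p then (if u = u' then path_matrix p i j else (0::'k)) else 0)"
    unfolding matrix_coeff_def by (intro sum.cong) (auto simp: path_monomial_def)
  then show ?thesis by (cases "u = u'") (simp_all add: finite_weighted_paths)
qed

lemma ideal_matrix_kernel: "ideal matrix_kernel (complete_path_algebra X7 :: 'k::field X7_series ring)"
proof -
  let ?A = "complete_path_algebra X7 :: 'k X7_series ring"
  let ?M = "matrix_kernel :: 'k X7_series set"
  interpret ring ?A by (rule ring_complete_path_algebra[OF wf_digraph_X7])
  show ?thesis
  proof (rule idealI)
    show "ring ?A" by (rule ring_axioms)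
    show "subgroup ?M (add_monoid ?A)"
    proof (rule add.subgroupI)
      show "?M \<subseteq> carrier ?A" by (auto simp: matrix_kernel_def)
      have "\<zero>\<^bsub>?A\<^esub> \<in> ?M"
        using zero_closed by (simp add: matrix_kernel_def complete_path_algebra_simps matrix_coeff_def)
      then show "?M \<noteq> {}" by blast
    next
      fix f assume "f \<in> ?M"
      then show "\<ominus>\<^bsub>?A\<^esub> f \<in> ?M"
        using complete_path_algebra_uminus[OF wf_digraph_X7, of f] a_inv_closed[of f]
        by (simp add: matrix_kernel_def matrix_coeff_uminus)
    next
      fix f g assume "f \<in> ?M" "g \<in> ?M"
      then show "f \<oplus>\<^bsub>?A\<^esub> g \<in> ?M"
        using a_closed[of f g]
        by (simp add: matrix_kernel_def matrix_coeff_add complete_path_algebra_simps)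
    qed
  next
    fix f x assume f: "f \<in> ?M" and x: "x \<in> carrier ?A"
    have z: "matrix_coeff f u v n i j = 0" if "i < 2" "j < 2" for u v n i j
      using f that by (simp add: matrix_kernel_def)
    have "f \<in> carrier ?A" using f by (simp add: matrix_kernel_def)
    then have "x \<otimes>\<^bsub>?A\<^esub> f \<in> carrier ?A" "f \<otimes>\<^bsub>?A\<^esub> x \<in> carrier ?A" using x by simp_all
    then show "x \<otimes>\<^bsub>?A\<^esub> f \<in> ?M" "f \<otimes>\<^bsub>?A\<^esub> x \<in> ?M"
      unfolding matrix_kernel_def complete_path_algebra_simps
      by (simp_all add: matrix_coeff_mult z sum_lessThan_2)
  qed
qed

text \<open>In characteristic 2 the row of \<open>Gamma k\<close> is fixed by right multiplication
  with the sum of the matrices of the two other cycles, the column of \<open>Alpha k\<close> is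
  fixed by left multiplication with it, and the row times the column is 0.\<close>

lemma cyclic_derivative_matrix_kernel:
  assumes char: "CHAR('k::field) = 2" and a: "a \<in> arcs X7"
  shows "cyclic_derivative X7 a (X7_W (0::'k)) \<in> matrix_kernel"
proof -
  have two: "(2::'k) = 0" using char of_nat_CHAR[where 'a = 'k] by simp
  have car: "cyclic_derivative X7 a (X7_W (0::'k)) \<in> carrier (complete_path_algebra X7)"
    by (rule cyclic_derivative_carrier[OF wf_digraph_X7])
  have "matrix_coeff (cyclic_derivative X7 a (X7_W (0::'k))) u v n i j = 0"
    if ij: "i < 2" "j < 2" for u v n i j
  proof -
    have i: "i = 0 \<or> i = 1" and j: "j = 0 \<or> j = 1" using ij by auto
    have "\<exists>k l m. (k, l, m) \<in> cyclic_triples \<and> a \<in> {Alpha k, Beta k, Gamma k, Delta k}"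
      using a by (elim X7_arc_cases) (auto simp: cyclic_triples_def)
    then obtain k l m where klm: "(k, l, m) \<in> cyclic_triples" and a': "a \<in> {Alpha k, Beta k, Gamma k, Delta k}"
      by blast
    have range: "k \<in> {1, 2, 3}" "l \<in> {1, 2, 3}" "m \<in> {1, 2, 3}" using cyclic_triples_range[OF klm] by auto
    have klm': "k = 1 \<and> l = 2 \<and> m = 3 \<or> k = 2 \<and> l = 3 \<and> m = 1 \<or> k = 3 \<and> l = 1 \<and> m = 2"
      using klm by (auto simp: cyclic_triples_def)
    have A: "path_matrix [Beta k, Gamma k] i j + path_matrix ([Delta k, Gamma k] @ Delta_word l) i j
        + path_matrix ([Delta k, Gamma k] @ Delta_word m) i j = (0::'k)"
      using i j klm' by (elim disjE conjE; simp add: sum_lessThan_2 Delta_word_def two)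
    have B: "path_matrix [Gamma k, Alpha k] i j = (0::'k)"
      using i j klm' by (elim disjE conjE; simp add: sum_lessThan_2 Delta_word_def two)
    have C: "path_matrix [Alpha k, Beta k] i j + path_matrix (Delta_word l @ [Alpha k, Delta k]) i j
        + path_matrix (Delta_word m @ [Alpha k, Delta k]) i j = (0::'k)"
      using i j klm' by (elim disjE conjE; simp add: sum_lessThan_2 Delta_word_def two)
    have D: "path_matrix ([Gamma k] @ Delta_word l @ [Alpha k]) i j
        + path_matrix ([Gamma k] @ Delta_word m @ [Alpha k]) i j = (0::'k)"
      using i j klm' by (elim disjE conjE; simp add: sum_lessThan_2 Delta_word_def two)
    \<comment> \<open>All terms of one derivative share their endpoints and their weight, hence
      contribute to the same coefficients: the weight 4 of \<open>Beta k\<close> is that of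
      \<open>Delta k\<close> and one cycle of three arrows.\<close>
    have wA: "[Beta k, Gamma k] \<in> weighted_paths u v n \<longleftrightarrow> [Delta k, Gamma k] @ Delta_word l \<in> weighted_paths u v n"
      "[Beta k, Gamma k] \<in> weighted_paths u v n \<longleftrightarrow> [Delta k, Gamma k] @ Delta_word m \<in> weighted_paths u v n"
      "[Alpha k, Beta k] \<in> weighted_paths u v n \<longleftrightarrow> Delta_word l @ [Alpha k, Delta k] \<in> weighted_paths u v n"
      "[Alpha k, Beta k] \<in> weighted_paths u v n \<longleftrightarrow> Delta_word m @ [Alpha k, Delta k] \<in> weighted_paths u v n"
      "[Gamma k] @ Delta_word l @ [Alpha k] \<in> weighted_paths u v n \<longleftrightarrow>
       [Gamma k] @ Delta_word m @ [Alpha k] \<in> weighted_paths u v n"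
      using range by (auto simp: weighted_paths_def X7_awalk Delta_word_def)
    from a' consider "a = Alpha k" | "a = Beta k" | "a = Gamma k" | "a = Delta k" by blast
    then show ?thesis
    proof cases
      case 1
      show ?thesis unfolding 1 X7_cyclic_derivatives(1)[OF klm] matrix_coeff_add matrix_coeff_smult
        matrix_coeff_monomial wA[symmetric] using A by (auto simp del: path_matrix.simps append.simps)
    next
      case 2
      show ?thesis unfolding 2 X7_cyclic_derivatives(3)[OF klm] matrix_coeff_monomial using B by (auto simp del: path_matrix.simps append.simps)
    next
      case 3
      show ?thesis unfolding 3 X7_cyclic_derivatives(2)[OF klm] matrix_coeff_add matrix_coeff_smult
        matrix_coeff_monomial wA[symmetric] using C by (auto simp del: path_matrix.simps append.simps)
    next
      case 4
      show ?thesis unfolding 4 X7_cyclic_derivatives(4)[OF klm] matrix_coeff_add matrix_coeff_smult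
        matrix_coeff_monomial wA(5)[symmetric] using D by (auto simp del: path_matrix.simps append.simps)
    qed
  qed
  then show ?thesis using car by (simp add: matrix_kernel_def)
qed

text \<open>A coefficient of weight \<open>n\<close> involves only paths of length at most
  \<open>n\<close>, so its vanishing passes from the ideal to the closure.\<close>

lemma jacobian_ideal_matrix_kernel:
  assumes char: "CHAR('k::field) = 2" and f: "f \<in> jacobian_ideal X7 (X7_W (0::'k))"
    and ij: "i < 2" "j < 2"
  shows "matrix_coeff f u v n i j = 0"
proof -
  let ?A = "complete_path_algebra X7 :: 'k X7_series ring"
  interpret ring ?A by (rule ring_complete_path_algebra[OF wf_digraph_X7])
  have "Jacobian_relations (0::'k) \<subseteq> matrix_kernel"
    unfolding Jacobian_relations_def
    using cyclic_derivative_matrix_kernel[OF char] by (intro genideal_minimal ideal_matrix_kernel) auto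
  moreover obtain g where "g \<in> Jacobian_relations (0::'k)"
    and eq: "\<forall>u p. length p < Suc n \<longrightarrow> f (u, p) = g (u, p)"
    using f unfolding jacobian_ideal_def path_series_closure_def Jacobian_relations_def by blast
  ultimately have "matrix_coeff g u v n i j = 0" using ij by (auto simp: matrix_kernel_def)
  moreover have "matrix_coeff f u v n i j = matrix_coeff g u v n i j"
    unfolding matrix_coeff_def
  proof (intro sum.cong refl)
    fix p assume "p \<in> weighted_paths u v n"
    then have "length p < Suc n" using length_le_path_weight[of p] by (auto simp: weighted_paths_def)
    then show "f (u, p) * path_matrix p i j = g (u, p) * path_matrix p i j" using eq by simp
  qed
  ultimately show ?thesis by simp
qed

section \<open>Linear independence of the powers of a cycle\<close>

definition X7_power :: "nat \<Rightarrow> 'k::field X7_series" where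
  "X7_power n = Delta_monomial (concat (replicate n [1, 2]))"

lemma X7_power_carrier: "X7_power n \<in> carrier (complete_path_algebra X7)"
  unfolding X7_power_def by (rule Delta_monomial_carrier) auto

text \<open>Each factor has weight 6 and is mapped to an idempotent matrix unit with entry 1 at
  \<open>(0, 0)\<close>, so the weight tells the powers apart.\<close>

lemma matrix_coeff_X7_power:
  "matrix_coeff (X7_power n) 0 0 (6 * m) 0 0 = (if m = n then 1 else 0)"
proof -
  let ?p = "concat (map Delta_word (concat (replicate n [1, 2])))"
  have "path_weight ?p = 6 * n" by (induction n) (simp_all add: Delta_word_def)
  moreover have "pre_digraph.awalk X7 0 ?p 0"
    using Delta_words_cas by (auto simp: X7_awalk Delta_word_def)
  moreover have "path_matrix ?p 0 0 = (1::'a)"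
    by (induction n) (simp_all add: Delta_word_def sum_lessThan_2)
  ultimately show ?thesis
    by (auto simp: X7_power_def Delta_monomial_def matrix_coeff_monomial weighted_paths_def)
qed

text \<open>The coefficients of weight \<open>6 * n\<close> form a system dual to the powers and
  read off the scalars of a combination.\<close>

lemma matrix_coeff_combination:
  fixes cs :: "'k::field list"
  assumes "length cs = length ns" "distinct ns" "l < length ns"
  shows "matrix_coeff (ring.combine (complete_path_algebra X7)
      (map (path_series_scalar X7) cs) (map X7_power ns)) 0 0 (6 * ns ! l) 0 0 = cs ! l"
proof -
  interpret A: ring "complete_path_algebra X7 :: 'k X7_series ring"
    by (rule ring_complete_path_algebra[OF wf_digraph_X7])
  let ?c = "\<lambda>cs ns. A.combine (map (path_series_scalar X7) cs) (map X7_power ns)"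
  have step: "matrix_coeff (?c (c # cs) (n # ns)) 0 0 (6 * m) 0 0 =
      (if m = n then c else 0) + matrix_coeff (?c cs ns) 0 0 (6 * m) 0 0" for c cs n ns m
    using path_series_scalar_mult(1)[OF wf_digraph_X7 X7_power_carrier, of c n]
    by (simp add: complete_path_algebra_simps matrix_coeff_add matrix_coeff_smult matrix_coeff_X7_power)
  have out: "matrix_coeff (?c cs ns) 0 0 (6 * m) 0 0 = 0" if "m \<notin> set ns" "length cs = length ns" for cs ns m
    using that
  proof (induction cs arbitrary: ns)
    case Nil
    then show ?case by (simp add: complete_path_algebra_simps matrix_coeff_def)
  next
    case (Cons c cs)
    then obtain n ns' where "ns = n # ns'" by (cases ns) auto
    then show ?case using Cons step by simp
  qed
  show ?thesis
    using assms
  proof (induction cs arbitrary: ns l)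
    case (Cons c cs)
    then obtain n ns' where ns: "ns = n # ns'" by (cases ns) auto
    show ?case
    proof (cases l)
      case 0
      then show ?thesis using Cons.prems step[of c cs n ns' n] out[of n ns' cs] by (simp add: ns)
    next
      case (Suc l')
      moreover have "ns' ! l' \<noteq> n" using Cons.prems Suc ns by auto
      ultimately show ?thesis
        using Cons.prems Cons.IH[of ns' l'] step[of c cs n ns' "ns' ! l'"] by (simp add: ns)
    qed
  qed simp
qed

lemma infinite_dim_X7_char_2:
  assumes char: "CHAR('k::field) = 2"
  shows "\<not> finite_dim_jacobian_algebra X7 (X7_W (0::'k))"
proof
  let ?A = "complete_path_algebra X7 :: 'k X7_series ring"
  let ?W = "X7_W (0::'k)"
  let ?J = "jacobian_ideal X7 ?W"
  let ?L = "jacobian_algebra X7 ?W" and ?K = "jacobian_scalars X7 ?W"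
  interpret A: ring ?A by (rule ring_complete_path_algebra[OF wf_digraph_X7])
  interpret L: ring ?L by (rule ring_jacobian_algebra[OF wf_digraph_X7])
  interpret J: ideal ?J ?A by (rule ideal_jacobian_ideal[OF wf_digraph_X7])
  define h where "h = (+>\<^bsub>?A\<^esub>) ?J"
  interpret h: ring_hom_ring ?A ?L h
    unfolding jacobian_algebra_def h_def by (rule J.rcos_ring_hom_ring)
  have K: "subfield ?K ?L"
    by (rule subfield_jacobian_scalars[OF wf_digraph_X7 _ X7_potential]) (simp add: X7_def)
  assume "finite_dim_jacobian_algebra X7 ?W"
  then obtain N where N: "L.dimension N ?K (carrier ?L)"
    unfolding finite_dim_jacobian_algebra_def L.finite_dimension_def by blast
  \<comment> \<open>One power more than the assumed dimension.\<close>
  define Us where "Us = map h (map X7_power [0..<Suc N])"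
  have Us: "set Us \<subseteq> carrier ?L"
    unfolding Us_def by (auto intro!: h.hom_closed X7_power_carrier simp del: upt_Suc)
  have "L.independent ?K Us"
  proof (rule ccontr)
    assume "\<not> L.independent ?K Us"
    then obtain Ks where Ks: "length Ks = length Us" "L.combine Ks Us = \<zero>\<^bsub>?L\<^esub>" "set Ks \<subseteq> ?K" "set Ks \<noteq> {\<zero>\<^bsub>?L\<^esub>}"
      using L.dependent_imp_non_trivial_combine[OF K Us] by blast
    have "set Ks \<subseteq> range (\<lambda>c. h (path_series_scalar X7 c))"
      using Ks(3) by (simp add: jacobian_scalars_def h_def)
    \<comment> \<open>The scalars of the quotient come from the ground field, so the vanishing
      combination lifts to one in the path algebra, which then lies in the Jacobian ideal.\<close>
    then have "\<exists>cs. Ks = map (\<lambda>c. h (path_series_scalar X7 c)) cs"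
      by (induction Ks) (auto, metis list.simps(9))
    then obtain cs where "Ks = map (\<lambda>c. h (path_series_scalar X7 c)) cs" by blast
    then have cs: "Ks = map h (map (path_series_scalar X7) cs)" by simp
    let ?c = "A.combine (map (path_series_scalar X7) cs) (map X7_power [0..<Suc N])"
    have sub: "set (map (path_series_scalar X7) cs) \<subseteq> carrier ?A"
      "set (map X7_power [0..<Suc N]) \<subseteq> carrier ?A"
      using path_series_scalar_carrier[OF wf_digraph_X7] X7_power_carrier by auto
    have "h ?c = \<zero>\<^bsub>?L\<^esub>" using Ks(2) unfolding cs Us_def h.combine_hom[OF sub] .
    then have "?J +>\<^bsub>?A\<^esub> ?c = ?J" by (simp add: h_def jacobian_algebra_def FactRing_def)
    then have cJ: "?c \<in> ?J" using J.a_rcos_self[OF A.combine_in_carrier[OF sub]] by simp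
    have len: "length cs = length [0..<Suc N]" using Ks(1) cs by (simp add: Us_def)
    have "cs ! l = 0" if "l < length cs" for l
      using matrix_coeff_combination[OF len distinct_upt, of l] that len
        jacobian_ideal_matrix_kernel[OF char cJ, of 0 0] by simp
    then have "c = 0" if "c \<in> set cs" for c using that by (auto simp: in_set_conv_nth)
    then have "set Ks \<subseteq> {h (path_series_scalar X7 0)}" using cs by auto
    moreover have "path_series_scalar X7 0 = \<zero>\<^bsub>?A\<^esub>"
      by (auto simp: path_series_scalar_def complete_path_algebra_simps)
    moreover have "set Ks \<noteq> {}" using Ks(1) by (auto simp: Us_def)
    ultimately show False using Ks(4) h.hom_zero by (metis subset_singletonD)
  qed
  then have "length Us \<le> N" using L.independent_length_le_dimension[OF K N] Us by blast
  then show False by (simp add: Us_def)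
qed

theorem theorem2:
  shows "(CHAR('k::field) \<noteq> 2 \<longrightarrow>
            finite_dim_jacobian_algebra X7 (X7_W0 :: 'k X7_series) \<and>
            finite_dim_jacobian_algebra X7 (X7_W1 :: 'k X7_series)) \<and>
         (CHAR('k) = 2 \<longrightarrow>
            \<not> finite_dim_jacobian_algebra X7 (X7_W0 :: 'k X7_series) \<and>
            finite_dim_jacobian_algebra X7 (X7_W1 :: 'k X7_series))"
  unfolding X7_W0_conv X7_W1_conv
  using finite_dim_X7_char_not_2 finite_dim_X7_char_2 infinite_dim_X7_char_2 by blast

end
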